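(* Let $\Phi$ be the root system $\mathrm{G}_2$ with short simple root $\alpha_1$ and long simple root $\alpha_2$, and let $\Phi_s,\Phi_l$ (respectively $\Phi_s^+,\Phi_l^+$) be the sets of short and long roots (respectively positive short and positive long roots). Define \[ G(K,M)=\frac13\,\frac{(3K+3M)!!\,(3K)!!\,(2K)!!\,(2M)!!}{(3K+2M)!!\,(2K+M)!!\,(K+M)!!\,K!!\,K!!\,M!!}. \] Then for all nonnegative integers $k,m$, \[ \mathrm{CT}\bigg[\mathrm{e}^{-3\alpha_1-2\alpha_2}\log(1-\mathrm{e}^{\alpha_2})\prod_{\alpha\in\Phi_l^+}(1-\mathrm{e}^{\alpha})\prod_{\alpha\in\Phi_l}(1-\mathrm{e}^{\alpha})^k\prod_{\alpha\in\Phi_s}(1-\mathrm{e}^{\alpha})^m\bigg]=G(K,M)\quad\text{with }(K,M):=(2k+1,2m), \] and \[ \mathrm{CT}\bigg[\mathrm{e}^{-2\alpha_1-\alpha_2}\log(1-\mathrm{e}^{\alpha_1})\prod_{\alpha\in\Phi_s^+}(1-\mathrm{e}^{\alpha})\prod_{\alpha\in\Phi_l}(1-\mathrm{e}^{\alpha})^k\prod_{\alpha\in\Phi_s}(1-\mathrm{e}^{\alpha})^m\bigg]=G(K,M)\quad\text{with }(K,M):=(2k,2m+1). \]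
   Context: With $\epsilon_i$ the standard unit vectors of $\mathbb{R}^3$, the simple roots of $\mathrm{G}_2$ are $\alpha_1=\epsilon_1-\epsilon_2$ and $\alpha_2=2\epsilon_2-\epsilon_1-\epsilon_3$. The positive short roots are $\alpha_1$, $\alpha_1+\alpha_2=\epsilon_2-\epsilon_3$, $2\alpha_1+\alpha_2=\epsilon_1-\epsilon_3$. The positive long roots are $\alpha_2$, $3\alpha_1+\alpha_2=2\epsilon_1-\epsilon_2-\epsilon_3$, $3\alpha_1+2\alpha_2=\epsilon_1+\epsilon_2-2\epsilon_3$. The remaining roots are the negatives of these. The $\mathrm{e}^{\lambda}$ are formal exponentials with $\mathrm{e}^{\lambda}\mathrm{e}^{\mu}=\mathrm{e}^{\lambda+\mu}$; equivalently $\mathrm{e}^{\epsilon_1}=x$, $\mathrm{e}^{\epsilon_2}=y$, $\mathrm{e}^{\epsilon_3}=z$, so that $\mathrm{e}^{\alpha_1}=x/y$ and $\mathrm{e}^{\alpha_2}=y^2/(xz)$. $\mathrm{CT}$ denotes the constant term, i.e. the coefficient of $\mathrm{e}^0$, and $\log(1-w)=-\sum_{N\ge1}w^N/N$ as a formal power series in $w=\mathrm{e}^{\alpha_i}$. $N!!$ is the double factorial, with $0!!=1$. *)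

theory Defs
  imports "HOL-Analysis.Analysis" "HOL-Library.Poly_Mapping"
    "HOL-Computational_Algebra.Formal_Power_Series"
begin

abbreviation \<epsilon> :: "3 \<Rightarrow> real^3" where
  "\<epsilon> i \<equiv> axis i 1"

definition \<alpha>1 :: "real^3" where
  "\<alpha>1 = \<epsilon> 1 - \<epsilon> 2"

definition \<alpha>2 :: "real^3" where
  "\<alpha>2 = 2 *\<^sub>R \<epsilon> 2 - \<epsilon> 1 - \<epsilon> 3"

definition short_pos_roots :: "(real^3) set" where
  "short_pos_roots = {\<alpha>1, \<alpha>1 + \<alpha>2, 2 *\<^sub>R \<alpha>1 + \<alpha>2}"

definition long_pos_roots :: "(real^3) set" where
  "long_pos_roots = {\<alpha>2, 3 *\<^sub>R \<alpha>1 + \<alpha>2, 3 *\<^sub>R \<alpha>1 + 2 *\<^sub>R \<alpha>2}"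

definition short_roots :: "(real^3) set" where
  "short_roots = short_pos_roots \<union> uminus ` short_pos_roots"

definition long_roots :: "(real^3) set" where
  "long_roots = long_pos_roots \<union> uminus ` long_pos_roots"

lemma short_pos_roots_eq:
  "short_pos_roots = {\<epsilon> 1 - \<epsilon> 2, \<epsilon> 2 - \<epsilon> 3, \<epsilon> 1 - \<epsilon> 3}"
proof -
  have "\<alpha>1 + \<alpha>2 = \<epsilon> 2 - \<epsilon> 3" "2 *\<^sub>R \<alpha>1 + \<alpha>2 = \<epsilon> 1 - \<epsilon> 3"
    by (simp_all add: \<alpha>1_def \<alpha>2_def vec_eq_iff)
  then show ?thesis by (simp only: short_pos_roots_def) (simp only: \<alpha>1_def)
qed

lemma long_pos_roots_eq:
  "long_pos_roots = {2 *\<^sub>R \<epsilon> 2 - \<epsilon> 1 - \<epsilon> 3, 2 *\<^sub>R \<epsilon> 1 - \<epsilon> 2 - \<epsilon> 3, \<epsilon> 1 + \<epsilon> 2 - 2 *\<^sub>R \<epsilon> 3}"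
proof -
  have "3 *\<^sub>R \<alpha>1 + \<alpha>2 = 2 *\<^sub>R \<epsilon> 1 - \<epsilon> 2 - \<epsilon> 3"
    "3 *\<^sub>R \<alpha>1 + 2 *\<^sub>R \<alpha>2 = \<epsilon> 1 + \<epsilon> 2 - 2 *\<^sub>R \<epsilon> 3"
    by (simp_all add: \<alpha>1_def \<alpha>2_def vec_eq_iff)
  then show ?thesis by (simp only: long_pos_roots_def) (simp only: \<alpha>2_def)
qed

text \<open>
  Finite rational combinations of formal exponentials form the group algebra
  \<^typ>\<open>(real^3) \<Rightarrow>\<^sub>0 rat\<close>, whose multiplication is convolution.
\<close>

definition fexp :: "real^3 \<Rightarrow> ((real^3) \<Rightarrow>\<^sub>0 rat)" where
  "fexp \<beta> = Poly_Mapping.single \<beta> 1"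

lemma fexp_mult: "fexp \<beta> * fexp \<gamma> = fexp (\<beta> + \<gamma>)"
  by (simp add: fexp_def mult_single)

lemma fexp_0: "fexp 0 = 1"
  by (simp add: fexp_def)

text \<open>
  A possibly infinite formal sum of terms \<open>c\<^sub>\<mu> e\<^sup>\<mu>\<close> is its coefficient function
  \<open>\<mu> \<mapsto> c\<^sub>\<mu>\<close>. Such sums cannot be multiplied with each other in general, but they
  form a module over the group algebra, with action \<open>lmult\<close>.
\<close>

type_synonym fseries = "real^3 \<Rightarrow> rat"

definition lmult :: "((real^3) \<Rightarrow>\<^sub>0 rat) \<Rightarrow> fseries \<Rightarrow> fseries" where
  "lmult P F = (\<lambda>\<mu>. \<Sum>\<beta>\<in>Poly_Mapping.keys P. Poly_Mapping.lookup P \<beta> * F (\<mu> - \<beta>))"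

definition CT :: "fseries \<Rightarrow> rat" where
  "CT F = F 0"

text \<open>
  Substitution of \<open>w = e\<^sup>\<alpha>\<close> in a power series in \<open>w\<close>, for \<open>\<alpha> \<noteq> 0\<close>; at most one
  \<open>N\<close> contributes to each coefficient.
\<close>

definition fps_at_fexp :: "rat fps \<Rightarrow> real^3 \<Rightarrow> fseries" where
  "fps_at_fexp f \<alpha> = (\<lambda>\<mu>. \<Sum>N | real N *\<^sub>R \<alpha> = \<mu>. fps_nth f N)"

lemma fps_at_fexp_scaleR:
  assumes "\<alpha> \<noteq> 0"
  shows "fps_at_fexp f \<alpha> (real N *\<^sub>R \<alpha>) = fps_nth f N"
  using assms by (simp add: fps_at_fexp_def)

definition fps_log_one_minus :: "rat fps" where
  "fps_log_one_minus = Abs_fps (\<lambda>N. if N = 0 then 0 else - (1 / of_nat N))"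

definition log_one_minus_fexp :: "real^3 \<Rightarrow> fseries" where
  "log_one_minus_fexp \<alpha> = fps_at_fexp fps_log_one_minus \<alpha>"

fun double_factorial :: "nat \<Rightarrow> nat" where
  "double_factorial 0 = 1"
| "double_factorial (Suc 0) = 1"
| "double_factorial (Suc (Suc n)) = Suc (Suc n) * double_factorial n"

definition dfac :: "nat \<Rightarrow> rat" where
  "dfac n = of_nat (double_factorial n)"

definition G :: "nat \<Rightarrow> nat \<Rightarrow> rat" where
  "G K M = 1 / 3 *
     ((dfac (3 * K + 3 * M) * dfac (3 * K) * dfac (2 * K) * dfac (2 * M)) /
      (dfac (3 * K + 2 * M) * dfac (2 * K + M) * dfac (K + M) * dfac K * dfac K * dfac M))"

end

theory Submission
  imports Defs
begin

text \<open>
  Put \<open>a = e\<^bsup>\<epsilon>\<^sub>1 - \<epsilon>\<^sub>2\<^esup>\<close>, \<open>b = e\<^bsup>\<epsilon>\<^sub>2 - \<epsilon>\<^sub>3\<^esup>\<close>, \<open>c = e\<^bsup>\<epsilon>\<^sub>3 - \<epsilon>\<^sub>1\<^esup>\<close>, so that \<open>a b c = 1\<close>, the short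
  roots are \<open>a\<close>, \<open>b\<close>, \<open>c\<close> and their inverses, and the long roots are the ratios of \<open>a\<close>, \<open>b\<close>,
  \<open>c\<close>. Treating \<open>a\<close>, \<open>b\<close>, \<open>c\<close> as independent, each constant term becomes a sum over \<open>q\<close> of
  coefficients of \<open>(a b c)\<^sup>q\<close>, and each summand is the constant term in Morris' identity for
  three variables with the logarithm inserted. By symmetry the logarithm may be replaced by a
  third of the sum of the three logarithms in its orbit, which amounts to a derivative with
  respect to an exponent. Aomoto's proof of Morris' identity uses only that symmetrised
  divergences have constant term zero, and it survives the insertion of this sum; it yields a
  first-order recursion in \<open>q\<close>.

  The sum over \<open>q\<close> is then a well-poised \<open>\<^sub>3F\<^sub>2\<close>: Dixon's sum at an even integer for the
  first identity, and its derivative at an odd integer, where the sum itself vanishes, for the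
  second. A contiguous relation that telescopes evaluates both. The normalisation at \<open>q = 0\<close> is the
  same kind of sum with the ratios of \<open>a\<close>, \<open>b\<close>, \<open>c\<close> in the role of \<open>a\<close>, \<open>b\<close>, \<open>c\<close>.
\<close>

section \<open>Formal Laurent polynomials paired with formal series\<close>

lemma poly_mapping_eq_sum_single:
  "p = (\<Sum>k\<in>Poly_Mapping.keys p. Poly_Mapping.single k (Poly_Mapping.lookup p k))"
  by (rule poly_mapping_eqI) (auto simp: lookup_sum lookup_single when_def in_keys_iff)

text \<open>Once additivity is known, identities that are linear in a Laurent polynomial reduce
  through this rule to monomials.\<close>

lemma poly_mapping_single_induct [case_names single add]:
  fixes p :: "'a \<Rightarrow>\<^sub>0 'b::comm_monoid_add"
  assumes "\<And>a c. Q (Poly_Mapping.single a c)"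
    and "\<And>p q. Q p \<Longrightarrow> Q q \<Longrightarrow> Q (p + q)"
  shows "Q p"
proof -
  have "Q (\<Sum>k\<in>A. Poly_Mapping.single k (f k))" if "finite A" for A f
    using that
  proof (induction A)
    case empty
    show ?case using assms(1)[of undefined 0] by simp
  next
    case (insert x A)
    then show ?case by (simp add: assms)
  qed
  then show ?thesis
    by (subst poly_mapping_eq_sum_single) simp
qed

text \<open>The constant term of the product of \<open>P\<close> with the formal series
  \<open>F\<close>, over an arbitrary exponent group. Integer triples and vectors of R^3 both serve
  as exponents, and this is the quantity transported between them.\<close>

definition pair :: "('a::ab_group_add \<Rightarrow>\<^sub>0 rat) \<Rightarrow> ('a \<Rightarrow> rat) \<Rightarrow> rat" where
  "pair P F = (\<Sum>\<beta>\<in>Poly_Mapping.keys P. Poly_Mapping.lookup P \<beta> * F (- \<beta>))"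

lemma pair_superset:
  assumes "finite A" "Poly_Mapping.keys P \<subseteq> A"
  shows "pair P F = (\<Sum>\<beta>\<in>A. Poly_Mapping.lookup P \<beta> * F (- \<beta>))"
  unfolding pair_def using assms
  by (intro sum.mono_neutral_left) (auto simp: in_keys_iff)

lemma pair_single [simp]: "pair (Poly_Mapping.single \<beta> c) F = c * F (- \<beta>)"
  by (simp add: pair_def)

lemma pair_zero [simp]: "pair 0 F = 0"
  by (simp add: pair_def)

lemma pair_add: "pair (P + Q) F = pair P F + pair Q F"
proof -
  let ?A = "Poly_Mapping.keys P \<union> Poly_Mapping.keys Q"
  have "Poly_Mapping.keys (P + Q) \<subseteq> ?A"
    by (rule Poly_Mapping.keys_add)
  then have "pair (P + Q) F = (\<Sum>\<beta>\<in>?A. Poly_Mapping.lookup (P + Q) \<beta> * F (- \<beta>))"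
    by (intro pair_superset) auto
  also have "\<dots> = pair P F + pair Q F"
    by (simp add: pair_superset[of ?A] lookup_add algebra_simps sum.distrib)
  finally show ?thesis .
qed

lemma pair_uminus: "pair (- P) F = - pair P F"
  using pair_add[of P "- P" F] by simp

lemma pair_diff: "pair (P - Q) F = pair P F - pair Q F"
  using pair_add[of P "- Q" F] by (simp add: pair_uminus)

lemma pair_of_int_mult: "pair (of_int n * P) F = of_int n * pair P F"
proof (induction n rule: int_induct[where k = 0])
  case base
  show ?case by simp
next
  case (step1 i)
  then show ?case by (simp add: pair_add algebra_simps)
next
  case (step2 i)
  then show ?case by (simp add: pair_diff algebra_simps)
qed

lemma pair_minus_one_power: "pair ((- 1) ^ n * P) F = (- 1) ^ n * pair P F"
  by (induction n) (simp_all add: pair_uminus mult.assoc)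

lemma pair_add_right: "pair P (\<lambda>\<mu>. F \<mu> + F' \<mu>) = pair P F + pair P F'"
  by (simp add: pair_def algebra_simps sum.distrib)

text \<open>The indicator of 0 is the series 1, so results on a general insertion \<open>F\<close>
  specialise to plain constant terms.\<close>

lemma pair_delta: "pair P (\<lambda>\<mu>. if \<mu> = 0 then 1 else 0) = Poly_Mapping.lookup P 0"
  by (induction P rule: poly_mapping_single_induct)
    (auto simp: pair_add lookup_add lookup_single when_def)

section \<open>Change of exponents along an additive map\<close>

definition push :: "('a::ab_group_add \<Rightarrow> 'b::ab_group_add) \<Rightarrow> ('a \<Rightarrow>\<^sub>0 rat) \<Rightarrow> ('b \<Rightarrow>\<^sub>0 rat)" where
  "push h P = (\<Sum>\<beta>\<in>Poly_Mapping.keys P. Poly_Mapping.single (h \<beta>) (Poly_Mapping.lookup P \<beta>))"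

lemma push_superset:
  assumes "finite A" "Poly_Mapping.keys P \<subseteq> A"
  shows "push h P = (\<Sum>\<beta>\<in>A. Poly_Mapping.single (h \<beta>) (Poly_Mapping.lookup P \<beta>))"
  unfolding push_def using assms
  by (intro sum.mono_neutral_left) (auto simp: in_keys_iff)

lemma push_single [simp]: "push h (Poly_Mapping.single \<beta> c) = Poly_Mapping.single (h \<beta>) c"
  by (simp add: push_def)

lemma push_add: "push h (P + Q) = push h P + push h Q"
proof -
  let ?A = "Poly_Mapping.keys P \<union> Poly_Mapping.keys Q"
  have "Poly_Mapping.keys (P + Q) \<subseteq> ?A"
    by (rule Poly_Mapping.keys_add)
  then have "push h (P + Q) =
      (\<Sum>\<beta>\<in>?A. Poly_Mapping.single (h \<beta>) (Poly_Mapping.lookup (P + Q) \<beta>))"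
    by (intro push_superset) auto
  also have "\<dots> = push h P + push h Q"
    by (simp add: push_superset[of ?A] lookup_add single_add sum.distrib)
  finally show ?thesis .
qed

lemma push_zero [simp]: "push h 0 = 0"
  by (simp add: push_def)

lemma push_uminus: "push h (- P) = - push h P"
  using push_add[of h P "- P"] by (simp add: eq_neg_iff_add_eq_0 add.commute)

lemma push_diff: "push h (P - Q) = push h P - push h Q"
  using push_add[of h P "- Q"] by (simp add: push_uminus)

lemma push_one: "Modules.additive h \<Longrightarrow> push h 1 = 1"
  using push_single[of h 0 1] by (simp add: Modules.additive.zero)

lemma push_mult:
  assumes "Modules.additive h"
  shows "push h (P * Q) = push h P * push h Q"
proof (induction P rule: poly_mapping_single_induct)
  case (single a c)
  show ?case
  proof (induction Q rule: poly_mapping_single_induct)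
    case (single b d)
    show ?case by (simp add: mult_single Modules.additive.add[OF assms])
  next
    case (add p q)
    then show ?case by (simp add: distrib_left push_add)
  qed
next
  case (add p q)
  then show ?case by (simp add: distrib_right push_add)
qed

lemma push_power: "Modules.additive h \<Longrightarrow> push h (P ^ n) = push h P ^ n"
  by (induction n) (simp_all add: push_one push_mult)

text \<open>Adjunction: substituting in the polynomial amounts to pulling back the coefficient
  function of the series.\<close>

lemma pair_push:
  assumes "Modules.additive h"
  shows "pair (push h P) F = pair P (\<lambda>\<mu>. F (h \<mu>))"
  by (induction P rule: poly_mapping_single_induct)
    (simp_all add: pair_add push_add Modules.additive.minus[OF assms])

section \<open>Euler derivations and integration by parts\<close>

definition deriv_along :: "('a \<Rightarrow> rat) \<Rightarrow> ('a::ab_group_add \<Rightarrow>\<^sub>0 rat) \<Rightarrow> ('a \<Rightarrow>\<^sub>0 rat)" where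
  "deriv_along d P = Poly_Mapping.mapp (\<lambda>\<beta> c. d \<beta> * c) P"

lemma lookup_deriv_along:
  "Poly_Mapping.lookup (deriv_along d P) \<beta> = d \<beta> * Poly_Mapping.lookup P \<beta>"
  by (auto simp: deriv_along_def lookup_mapp when_def in_keys_iff)

lemma deriv_along_single [simp]:
  "deriv_along d (Poly_Mapping.single \<beta> c) = Poly_Mapping.single \<beta> (d \<beta> * c)"
  by (rule poly_mapping_eqI) (auto simp: lookup_deriv_along lookup_single when_def)

lemma deriv_along_add: "deriv_along d (P + Q) = deriv_along d P + deriv_along d Q"
  by (rule poly_mapping_eqI) (simp add: lookup_deriv_along lookup_add algebra_simps)

lemma deriv_along_diff: "deriv_along d (P - Q) = deriv_along d P - deriv_along d Q"
  by (rule poly_mapping_eqI) (simp add: lookup_deriv_along lookup_minus algebra_simps)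

lemma deriv_along_one: "Modules.additive d \<Longrightarrow> deriv_along d 1 = 0"
  using deriv_along_single[of d 0 1] by (simp add: Modules.additive.zero)

text \<open>For additive \<open>d\<close> this is an Euler operator such as x d/dx, hence a
  derivation.\<close>

lemma deriv_along_mult:
  assumes "Modules.additive d"
  shows "deriv_along d (P * Q) = deriv_along d P * Q + P * deriv_along d Q"
proof (induction P rule: poly_mapping_single_induct)
  case (single a c)
  show ?case
  proof (induction Q rule: poly_mapping_single_induct)
    case (single b e)
    show ?case
      by (simp add: mult_single Modules.additive.add[OF assms] flip: single_add)
        (simp add: algebra_simps)
  next
    case (add p q)
    then show ?case by (simp add: algebra_simps deriv_along_add)
  qed
next
  case (add p q)
  then show ?case by (simp add: algebra_simps deriv_along_add)
qed

lemma deriv_along_power_Suc: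
  assumes "Modules.additive d"
  shows "deriv_along d (P ^ Suc n) = of_nat (Suc n) * P ^ n * deriv_along d P"
proof (induction n)
  case 0
  show ?case by simp
next
  case (Suc n)
  have "deriv_along d (P ^ Suc (Suc n)) =
      deriv_along d P * P ^ Suc n + P * deriv_along d (P ^ Suc n)"
    by (subst power_Suc) (rule deriv_along_mult[OF assms])
  also have "\<dots> = of_nat (Suc (Suc n)) * P ^ Suc n * deriv_along d P"
    unfolding Suc.IH by (simp add: algebra_simps)
  finally show ?case .
qed

text \<open>Integration by parts: the constant term of a derivative is zero, so the derivation moves
  to the series, where it multiplies the coefficient at \<mu> by \<open>d \<mu>\<close>.\<close>

lemma pair_deriv_along:
  assumes "Modules.additive d"
  shows "pair (deriv_along d P) F = - pair P (\<lambda>\<mu>. d \<mu> * F \<mu>)"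
  by (induction P rule: poly_mapping_single_induct)
    (simp_all add: pair_add deriv_along_add Modules.additive.minus[OF assms])

section \<open>The logarithm along a ray\<close>

text \<open>A triple (i, j, l) is the exponent of a^i b^j c^l with a, b, c independent. The relation
  a b c = 1 is imposed later, by summing along \<open>diag\<close>.\<close>

type_synonym wt = "int \<times> int \<times> int"

fun smul :: "int \<Rightarrow> wt \<Rightarrow> wt" where
  "smul n (a, b, c) = (n * a, n * b, n * c)"

abbreviation diag :: wt where "diag \<equiv> (1, 1, 1)"

lemma smul_add: "smul (m + n) \<alpha> = smul m \<alpha> + smul n \<alpha>"
  by (cases \<alpha>) (simp add: algebra_simps)

lemma smul_diff: "smul (m - n) \<alpha> = smul m \<alpha> - smul n \<alpha>"
  by (cases \<alpha>) (simp add: algebra_simps)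

lemma smul_one [simp]: "smul 1 \<alpha> = \<alpha>"
  by (cases \<alpha>) simp

lemma smul_cancel: "\<alpha> \<noteq> 0 \<Longrightarrow> smul m \<alpha> = smul n \<alpha> \<longleftrightarrow> m = n"
  by (cases \<alpha>) (auto simp: zero_prod_def)

lemma additive_smul:
  assumes "Modules.additive (d :: wt \<Rightarrow> rat)"
  shows "d (smul n \<alpha>) = of_int n * d \<alpha>"
proof (induction n rule: int_induct[where k = 0])
  case base
  have "smul 0 \<alpha> = 0" by (cases \<alpha>) (simp add: zero_prod_def)
  then show ?case by (simp add: Modules.additive.zero[OF assms])
next
  case (step1 i)
  then show ?case by (simp add: smul_add Modules.additive.add[OF assms] algebra_simps)
next
  case (step2 i)
  then show ?case by (simp add: smul_diff Modules.additive.diff[OF assms] algebra_simps)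
qed

text \<open>The coefficient function of \<open>log (1 - e\<^sup>\<alpha>)\<close>, for \<open>\<alpha> \<noteq> 0\<close>.\<close>

definition ray_log :: "wt \<Rightarrow> wt \<Rightarrow> rat" where
  "ray_log \<alpha> \<mu> = (if \<exists>n\<ge>1. \<mu> = smul n \<alpha> then - 1 / of_int (THE n. \<mu> = smul n \<alpha>) else 0)"

lemma ray_log_smul:
  assumes "\<alpha> \<noteq> 0"
  shows "ray_log \<alpha> (smul n \<alpha>) = (if n \<ge> 1 then - 1 / of_int n else 0)"
  using assms by (auto simp: ray_log_def smul_cancel)

lemma ray_log_outside: "(\<And>n. n \<ge> 1 \<Longrightarrow> \<mu> \<noteq> smul n \<alpha>) \<Longrightarrow> ray_log \<alpha> \<mu> = 0"
  by (auto simp: ray_log_def)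

text \<open>Differentiating log (1 - e^\<alpha>) gives -d(\<alpha>) times the geometric series in
  e^\<alpha> without its constant term; after multiplication by 1 - e^\<alpha> only the term at
  \<alpha> survives.\<close>

lemma ray_log_telescope:
  assumes "Modules.additive d" "\<alpha> \<noteq> 0"
  shows "d \<mu> * ray_log \<alpha> \<mu> - d (\<mu> - \<alpha>) * ray_log \<alpha> (\<mu> - \<alpha>) = (if \<mu> = \<alpha> then - d \<alpha> else 0)"
proof (cases "\<exists>n. \<mu> = smul n \<alpha>")
  case True
  then obtain n where n: "\<mu> = smul n \<alpha>" by blast
  have n': "\<mu> - \<alpha> = smul (n - 1) \<alpha>" by (simp add: n smul_diff)
  have eq: "smul n \<alpha> = \<alpha> \<longleftrightarrow> n = 1"
    using smul_cancel[OF assms(2), of n 1] by simp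
  consider "n \<le> 0" | "n = 1" | "n \<ge> 2" by linarith
  then show ?thesis
    unfolding n' unfolding n ray_log_smul[OF assms(2)] additive_smul[OF assms(1)] eq
    by cases auto
next
  case False
  have "\<mu> - \<alpha> \<noteq> smul n \<alpha>" for n
  proof
    assume "\<mu> - \<alpha> = smul n \<alpha>"
    then have "\<mu> = smul (n + 1) \<alpha>" by (simp add: smul_add eq_diff_eq diff_eq_eq)
    with False show False by blast
  qed
  moreover have "\<mu> \<noteq> \<alpha>"
    using False smul_one by metis
  ultimately show ?thesis using False by (simp add: ray_log_outside)
qed

text \<open>A factor 1 - e^\<alpha> clears the denominator of the differentiated logarithm, and an
  ordinary constant term remains. This is how logarithms disappear from divergences.\<close>

lemma pair_log_cancel:
  assumes "Modules.additive d" "\<alpha> \<noteq> 0"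
  shows "pair ((1 - Poly_Mapping.single \<alpha> 1) * P) (\<lambda>\<mu>. d \<mu> * ray_log \<alpha> \<mu>) =
    - d \<alpha> * Poly_Mapping.lookup (Poly_Mapping.single \<alpha> 1 * P) 0"
proof (induction P rule: poly_mapping_single_induct)
  case (single \<beta> c)
  have "- \<beta> - \<alpha> = - \<alpha> - \<beta>" by simp
  then have tel: "d (- \<beta>) * ray_log \<alpha> (- \<beta>) - d (- \<alpha> - \<beta>) * ray_log \<alpha> (- \<alpha> - \<beta>) =
      (if - \<beta> = \<alpha> then - d \<alpha> else 0)"
    using ray_log_telescope[OF assms, of "- \<beta>"] by metis
  have eq: "\<alpha> + \<beta> = 0 \<longleftrightarrow> - \<beta> = \<alpha>"
    by (metis add.commute add_eq_0_iff minus_minus)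
  have "pair ((1 - Poly_Mapping.single \<alpha> 1) * Poly_Mapping.single \<beta> c) (\<lambda>\<mu>. d \<mu> * ray_log \<alpha> \<mu>) =
      c * (d (- \<beta>) * ray_log \<alpha> (- \<beta>) - d (- \<alpha> - \<beta>) * ray_log \<alpha> (- \<alpha> - \<beta>))"
    by (simp add: left_diff_distrib mult_single pair_diff right_diff_distrib)
  then show ?case
    unfolding tel by (simp add: mult_single lookup_single when_def eq)
next
  case (add p q)
  then show ?case by (simp add: distrib_left pair_add lookup_add)
qed

section \<open>Aomoto's recursion in three variables\<close>

abbreviation emon :: "wt \<Rightarrow> (wt \<Rightarrow>\<^sub>0 rat)" where
  "emon \<alpha> \<equiv> Poly_Mapping.single \<alpha> 1"

text \<open>\<open>X\<close>, \<open>Y\<close>, \<open>Z\<close> are the independent variables a, b,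
  c, and \<open>E n\<close> is (a b c)^n.\<close>

definition X :: "wt \<Rightarrow>\<^sub>0 rat" where "X = emon (1, 0, 0)"
definition Y :: "wt \<Rightarrow>\<^sub>0 rat" where "Y = emon (0, 1, 0)"
definition Z :: "wt \<Rightarrow>\<^sub>0 rat" where "Z = emon (0, 0, 1)"

definition E :: "int \<Rightarrow> (wt \<Rightarrow>\<^sub>0 rat)" where "E n = emon (n, n, n)"

definition Vdm :: "wt \<Rightarrow>\<^sub>0 rat" where "Vdm = (X - Y) * (Y - Z) * (Z - X)"

definition Lin :: "wt \<Rightarrow>\<^sub>0 rat" where "Lin = (1 - X) * (1 - Y) * (1 - Z)"

text \<open>The kernel of Morris' identity: its constant term is the coefficient of (X Y Z)^q in
  \<open>Lin ^ v * (E (- 1) * Vdm) ^ u\<close>.\<close>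

definition Phi :: "nat \<Rightarrow> nat \<Rightarrow> int \<Rightarrow> (wt \<Rightarrow>\<^sub>0 rat)" where
  "Phi u v q = E (- q - int u) * Lin ^ v * Vdm ^ u"

definition d1 :: "wt \<Rightarrow> rat" where "d1 \<mu> = of_int (fst \<mu>)"
definition d2 :: "wt \<Rightarrow> rat" where "d2 \<mu> = of_int (fst (snd \<mu>))"
definition d3 :: "wt \<Rightarrow> rat" where "d3 \<mu> = of_int (snd (snd \<mu>))"

lemma additive_d: "Modules.additive d1" "Modules.additive d2" "Modules.additive d3"
  by (simp_all add: Modules.additive_def d1_def d2_def d3_def)

abbreviation "\<theta>1 \<equiv> deriv_along d1"
abbreviation "\<theta>2 \<equiv> deriv_along d2"
abbreviation "\<theta>3 \<equiv> deriv_along d3"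

lemma E_add: "E (m + n) = E m * E n"
  by (simp add: E_def mult_single)

lemma E_zero [simp]: "E 0 = 1"
  by (simp add: E_def flip: zero_prod_def)

lemma E_one: "E 1 = X * Y * Z"
  by (simp add: E_def X_def Y_def Z_def mult_single)

lemma E_power: "E m ^ n = E (m * int n)"
  by (induction n) (simp_all add: algebra_simps E_add)

lemma \<theta>_gen [simp]:
  "\<theta>1 X = X" "\<theta>1 Y = 0" "\<theta>1 Z = 0"
  "\<theta>2 X = 0" "\<theta>2 Y = Y" "\<theta>2 Z = 0"
  "\<theta>3 X = 0" "\<theta>3 Y = 0" "\<theta>3 Z = Z"
  by (simp_all add: X_def Y_def Z_def d1_def d2_def d3_def)

lemma of_int_mult_single:
  "of_int n * Poly_Mapping.single \<alpha> c = Poly_Mapping.single \<alpha> (of_int n * c)" for c :: rat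
  by (simp add: mult_single flip: single_of_int)

lemma \<theta>_E: "\<theta>1 (E n) = of_int n * E n" "\<theta>2 (E n) = of_int n * E n" "\<theta>3 (E n) = of_int n * E n"
  by (simp_all add: E_def d1_def d2_def d3_def of_int_mult_single)

lemmas \<theta>_mult = additive_d[THEN deriv_along_mult]
lemmas \<theta>_simps = \<theta>_mult deriv_along_add deriv_along_diff additive_d[THEN deriv_along_one]

text \<open>The factor 1 - x_i, which the vector fields contain, makes the logarithmic derivative
  polynomial and avoids the exponent v - 1.\<close>

lemma \<theta>_Lin_power:
  "(1 - X) * \<theta>1 (Lin ^ v) = - of_nat v * X * Lin ^ v"
  "(1 - Y) * \<theta>2 (Lin ^ v) = - of_nat v * Y * Lin ^ v"
  "(1 - Z) * \<theta>3 (Lin ^ v) = - of_nat v * Z * Lin ^ v"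
proof -
  have L: "\<theta>1 Lin = - X * (1 - Y) * (1 - Z)" "\<theta>2 Lin = - Y * (1 - X) * (1 - Z)"
    "\<theta>3 Lin = - Z * (1 - X) * (1 - Y)"
    by (simp_all add: Lin_def \<theta>_simps algebra_simps)
  show "(1 - X) * \<theta>1 (Lin ^ v) = - of_nat v * X * Lin ^ v"
    "(1 - Y) * \<theta>2 (Lin ^ v) = - of_nat v * Y * Lin ^ v"
    "(1 - Z) * \<theta>3 (Lin ^ v) = - of_nat v * Z * Lin ^ v"
    by (cases v;
        simp only: additive_d[THEN deriv_along_power_Suc] additive_d[THEN deriv_along_one] L power_0;
        simp add: Lin_def algebra_simps)+
qed

text \<open>
  Symmetrised divergence of the vector field with components
  \<open>g\<^sub>i (1 - x\<^sub>i) \<Phi>\<close>, where \<open>g\<^sub>i\<close> is the elementary symmetric polynomial of degree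
  \<open>r - 1\<close> in the two variables other than \<open>x\<^sub>i\<close>.
\<close>

definition divg :: "(wt \<Rightarrow>\<^sub>0 rat) \<Rightarrow> (wt \<Rightarrow>\<^sub>0 rat) \<Rightarrow> (wt \<Rightarrow>\<^sub>0 rat) \<Rightarrow> (wt \<Rightarrow>\<^sub>0 rat) \<Rightarrow> (wt \<Rightarrow>\<^sub>0 rat)" where
  "divg g\<^sub>1 g\<^sub>2 g\<^sub>3 P =
     \<theta>1 (g\<^sub>1 * ((1 - X) * P)) + \<theta>2 (g\<^sub>2 * ((1 - Y) * P)) + \<theta>3 (g\<^sub>3 * ((1 - Z) * P))"

lemma \<theta>_Vdm:
  "\<theta>1 Vdm = X * (Y - Z) * (Y + Z - 2 * X)"
  "\<theta>2 Vdm = Y * (Z - X) * (Z + X - 2 * Y)"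
  "\<theta>3 Vdm = Z * (X - Y) * (X + Y - 2 * Z)"
  by (simp_all add: Vdm_def \<theta>_simps algebra_simps)

text \<open>\<open>K\<close> is u Vdm^(u - 1), read as 0 for u = 0. A common multiplier allows the
  three derivatives to be combined before \<open>Vdm\<close> is factored out.\<close>

lemma \<theta>_Vdm_power:
  obtains K where "K * Vdm = of_nat u * Vdm ^ u"
    "\<theta>1 (Vdm ^ u) = K * \<theta>1 Vdm" "\<theta>2 (Vdm ^ u) = K * \<theta>2 Vdm" "\<theta>3 (Vdm ^ u) = K * \<theta>3 Vdm"
proof (cases u)
  case 0
  then show ?thesis
    by (intro that[of 0]) (simp_all add: additive_d[THEN deriv_along_one])
next
  case (Suc n)
  have "\<theta>1 (Vdm ^ u) = of_nat u * Vdm ^ n * \<theta>1 Vdm" "\<theta>2 (Vdm ^ u) = of_nat u * Vdm ^ n * \<theta>2 Vdm"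
    "\<theta>3 (Vdm ^ u) = of_nat u * Vdm ^ n * \<theta>3 Vdm"
    unfolding Suc by (rule additive_d[THEN deriv_along_power_Suc])+
  then show ?thesis
    by (intro that[of "of_nat u * Vdm ^ n"]) (simp_all add: Suc algebra_simps)
qed

text \<open>Logarithmic differentiation of the three factors of \<open>Phi\<close>. The first
  assumption says that the field maps \<open>Vdm\<close> to a multiple of itself, the others that
  each component is constant for its own derivation up to the factor 1 - x_i.\<close>

lemma divg_Phi_general:
  assumes "g\<^sub>1 * (1 - X) * \<theta>1 Vdm + g\<^sub>2 * (1 - Y) * \<theta>2 Vdm + g\<^sub>3 * (1 - Z) * \<theta>3 Vdm = c * Vdm"
    and "\<theta>1 g\<^sub>1 = 0" "\<theta>2 g\<^sub>2 = 0" "\<theta>3 g\<^sub>3 = 0"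
  shows "divg g\<^sub>1 g\<^sub>2 g\<^sub>3 (Phi u v q) =
     (of_nat u * c - of_int (1 + int v) * (g\<^sub>1 * X + g\<^sub>2 * Y + g\<^sub>3 * Z)
      + of_int (- q - int u) * (g\<^sub>1 * (1 - X) + g\<^sub>2 * (1 - Y) + g\<^sub>3 * (1 - Z))) * Phi u v q"
proof -
  obtain K where K: "K * Vdm = of_nat u * Vdm ^ u"
    "\<theta>1 (Vdm ^ u) = K * \<theta>1 Vdm" "\<theta>2 (Vdm ^ u) = K * \<theta>2 Vdm" "\<theta>3 (Vdm ^ u) = K * \<theta>3 Vdm"
    by (rule \<theta>_Vdm_power)
  define A B C n where "A = E (- q - int u)" and "B = Lin ^ v" and "C = Vdm ^ u"
    and "n = (of_int (- q - int u) :: wt \<Rightarrow>\<^sub>0 rat)"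
  have step1: "\<theta>1 (g\<^sub>1 * ((1 - X) * (A * B * C))) =
      (n * g\<^sub>1 * (1 - X) - (1 + of_nat v) * g\<^sub>1 * X) * (A * B * C) + g\<^sub>1 * (1 - X) * \<theta>1 Vdm * K * A * B"
  proof -
    have "\<theta>1 (g\<^sub>1 * ((1 - X) * (A * B * C))) =
        g\<^sub>1 * (- X * A * B * C + (1 - X) * \<theta>1 A * B * C + ((1 - X) * \<theta>1 B) * A * C
          + (1 - X) * A * B * \<theta>1 C)"
      using assms by (simp add: \<theta>_simps algebra_simps)
    also have "\<theta>1 A = n * A" by (simp add: A_def n_def \<theta>_E)
    also have "(1 - X) * \<theta>1 B = - of_nat v * X * B" by (simp add: B_def \<theta>_Lin_power)
    also have "\<theta>1 C = K * \<theta>1 Vdm" by (simp add: C_def K)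
    finally show ?thesis by (simp add: algebra_simps)
  qed
  have step2: "\<theta>2 (g\<^sub>2 * ((1 - Y) * (A * B * C))) =
      (n * g\<^sub>2 * (1 - Y) - (1 + of_nat v) * g\<^sub>2 * Y) * (A * B * C) + g\<^sub>2 * (1 - Y) * \<theta>2 Vdm * K * A * B"
  proof -
    have "\<theta>2 (g\<^sub>2 * ((1 - Y) * (A * B * C))) =
        g\<^sub>2 * (- Y * A * B * C + (1 - Y) * \<theta>2 A * B * C + ((1 - Y) * \<theta>2 B) * A * C
          + (1 - Y) * A * B * \<theta>2 C)"
      using assms by (simp add: \<theta>_simps algebra_simps)
    also have "\<theta>2 A = n * A" by (simp add: A_def n_def \<theta>_E)
    also have "(1 - Y) * \<theta>2 B = - of_nat v * Y * B" by (simp add: B_def \<theta>_Lin_power)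
    also have "\<theta>2 C = K * \<theta>2 Vdm" by (simp add: C_def K)
    finally show ?thesis by (simp add: algebra_simps)
  qed
  have step3: "\<theta>3 (g\<^sub>3 * ((1 - Z) * (A * B * C))) =
      (n * g\<^sub>3 * (1 - Z) - (1 + of_nat v) * g\<^sub>3 * Z) * (A * B * C) + g\<^sub>3 * (1 - Z) * \<theta>3 Vdm * K * A * B"
  proof -
    have "\<theta>3 (g\<^sub>3 * ((1 - Z) * (A * B * C))) =
        g\<^sub>3 * (- Z * A * B * C + (1 - Z) * \<theta>3 A * B * C + ((1 - Z) * \<theta>3 B) * A * C
          + (1 - Z) * A * B * \<theta>3 C)"
      using assms by (simp add: \<theta>_simps algebra_simps)
    also have "\<theta>3 A = n * A" by (simp add: A_def n_def \<theta>_E)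
    also have "(1 - Z) * \<theta>3 B = - of_nat v * Z * B" by (simp add: B_def \<theta>_Lin_power)
    also have "\<theta>3 C = K * \<theta>3 Vdm" by (simp add: C_def K)
    finally show ?thesis by (simp add: algebra_simps)
  qed
  \<comment> \<open>Only the sum of the three Vandermonde contributions is known to be a multiple of
    \<open>Vdm\<close>.\<close>
  have "g\<^sub>1 * (1 - X) * \<theta>1 Vdm * K * A * B + g\<^sub>2 * (1 - Y) * \<theta>2 Vdm * K * A * B
      + g\<^sub>3 * (1 - Z) * \<theta>3 Vdm * K * A * B =
      (g\<^sub>1 * (1 - X) * \<theta>1 Vdm + g\<^sub>2 * (1 - Y) * \<theta>2 Vdm + g\<^sub>3 * (1 - Z) * \<theta>3 Vdm) * (K * A * B)"
    by (simp add: algebra_simps)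
  also have "\<dots> = c * (K * Vdm) * A * B"
    unfolding assms(1) by (simp add: algebra_simps)
  also have "\<dots> = of_nat u * c * (A * B * C)"
    unfolding K(1) C_def by (simp add: algebra_simps)
  finally have Vpart: "g\<^sub>1 * (1 - X) * \<theta>1 Vdm * K * A * B + g\<^sub>2 * (1 - Y) * \<theta>2 Vdm * K * A * B
      + g\<^sub>3 * (1 - Z) * \<theta>3 Vdm * K * A * B = of_nat u * c * (A * B * C)" .
  have "divg g\<^sub>1 g\<^sub>2 g\<^sub>3 (A * B * C) =
      (n * g\<^sub>1 * (1 - X) - (1 + of_nat v) * g\<^sub>1 * X + (n * g\<^sub>2 * (1 - Y) - (1 + of_nat v) * g\<^sub>2 * Y)
       + (n * g\<^sub>3 * (1 - Z) - (1 + of_nat v) * g\<^sub>3 * Z)) * (A * B * C) + of_nat u * c * (A * B * C)"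
    unfolding divg_def step1 step2 step3 Vpart[symmetric] by (simp add: algebra_simps)
  also have "\<dots> = (of_nat u * c - (1 + of_nat v) * (g\<^sub>1 * X + g\<^sub>2 * Y + g\<^sub>3 * Z)
      + n * (g\<^sub>1 * (1 - X) + g\<^sub>2 * (1 - Y) + g\<^sub>3 * (1 - Z))) * (A * B * C)"
    by (simp add: algebra_simps)
  finally show ?thesis
    by (simp add: Phi_def A_def B_def C_def n_def)
qed

abbreviation "e1 \<equiv> X + Y + Z"
abbreviation "e2 \<equiv> X * Y + Y * Z + Z * X"
abbreviation "e3 \<equiv> X * Y * Z"

text \<open>Each left side is antisymmetric, hence a symmetric multiple of \<open>Vdm\<close>; these
  are the quotients for the fields with r = 1, 2, 3.\<close>

lemma \<theta>_Vdm_symmetric: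
  "1 * (1 - X) * \<theta>1 Vdm + 1 * (1 - Y) * \<theta>2 Vdm + 1 * (1 - Z) * \<theta>3 Vdm = (3 - 2 * e1) * Vdm"
  "(Y + Z) * (1 - X) * \<theta>1 Vdm + (Z + X) * (1 - Y) * \<theta>2 Vdm + (X + Y) * (1 - Z) * \<theta>3 Vdm =
    (e1 - 3 * e2) * Vdm"
  "Y * Z * (1 - X) * \<theta>1 Vdm + Z * X * (1 - Y) * \<theta>2 Vdm + X * Y * (1 - Z) * \<theta>3 Vdm =
    (- 3 * e3) * Vdm"
  unfolding \<theta>_Vdm by (simp_all add: Vdm_def algebra_simps)

text \<open>The divergence for r links the insertions of e_r and e_(r-1), where e_0 = 1. The three
  relations form a chain from e_0 to e_3.\<close>

lemma divg_Phi_1: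
  "divg 1 1 1 (Phi u v q) =
    of_int (q - 1 - int v - int u) * (e1 * Phi u v q) - of_int (3 * q) * Phi u v q"
proof -
  have "divg 1 1 1 (Phi u v q) =
     (of_nat u * (3 - 2 * e1) - of_int (1 + int v) * (1 * X + 1 * Y + 1 * Z)
      + of_int (- q - int u) * (1 * (1 - X) + 1 * (1 - Y) + 1 * (1 - Z))) * Phi u v q"
    by (rule divg_Phi_general[OF \<theta>_Vdm_symmetric(1)]) (rule additive_d[THEN deriv_along_one])+
  also have "\<dots> = of_int (q - 1 - int v - int u) * (e1 * Phi u v q) - of_int (3 * q) * Phi u v q"
    by (simp add: algebra_simps)
  finally show ?thesis .
qed

lemma divg_Phi_2:
  "divg (Y + Z) (Z + X) (X + Y) (Phi u v q) =
    of_int (2 * q - 2 - 2 * int v - int u) * (e2 * Phi u v q) - of_int (2 * q + int u) * (e1 * Phi u v q)"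
proof -
  have "divg (Y + Z) (Z + X) (X + Y) (Phi u v q) =
     (of_nat u * (e1 - 3 * e2) - of_int (1 + int v) * ((Y + Z) * X + (Z + X) * Y + (X + Y) * Z)
      + of_int (- q - int u) * ((Y + Z) * (1 - X) + (Z + X) * (1 - Y) + (X + Y) * (1 - Z))) * Phi u v q"
    by (rule divg_Phi_general[OF \<theta>_Vdm_symmetric(2)]) (simp_all add: deriv_along_add)
  also have "\<dots> = of_int (2 * q - 2 - 2 * int v - int u) * (e2 * Phi u v q)
      - of_int (2 * q + int u) * (e1 * Phi u v q)"
    by (simp add: algebra_simps)
  finally show ?thesis .
qed

lemma divg_Phi_3:
  "divg (Y * Z) (Z * X) (X * Y) (Phi u v q) =
    of_int (3 * q - 3 - 3 * int v) * (e3 * Phi u v q) - of_int (q + int u) * (e2 * Phi u v q)"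
proof -
  have "divg (Y * Z) (Z * X) (X * Y) (Phi u v q) =
     (of_nat u * (- 3 * e3) - of_int (1 + int v) * ((Y * Z) * X + (Z * X) * Y + (X * Y) * Z)
      + of_int (- q - int u) * ((Y * Z) * (1 - X) + (Z * X) * (1 - Y) + (X * Y) * (1 - Z))) * Phi u v q"
    by (rule divg_Phi_general[OF \<theta>_Vdm_symmetric(3)]) (simp_all add: \<theta>_mult)
  also have "\<dots> = of_int (3 * q - 3 - 3 * int v) * (e3 * Phi u v q)
      - of_int (q + int u) * (e2 * Phi u v q)"
    by (simp add: algebra_simps)
  finally show ?thesis .
qed

text \<open>Closes the chain: inserting e_3 lowers q by one, so the three relations make up one step
  of a recursion in q.\<close>

lemma e3_Phi: "e3 * Phi u v q = Phi u v (q - 1)"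
proof -
  have "E (- (q - 1) - int u) = E 1 * E (- q - int u)"
    by (simp flip: E_add add: algebra_simps)
  then show ?thesis
    by (simp add: Phi_def E_one algebra_simps)
qed

lemma Lin_Phi: "Phi u (Suc v) q = (1 - e1 + e2 - e3) * Phi u v q"
  by (simp add: Phi_def Lin_def algebra_simps)

subsection \<open>The constant term functional\<close>

abbreviation ct :: "(wt \<Rightarrow>\<^sub>0 rat) \<Rightarrow> rat" where
  "ct P \<equiv> Poly_Mapping.lookup P 0"

lemma ct_divg: "ct (divg g\<^sub>1 g\<^sub>2 g\<^sub>3 P) = 0"
  by (simp add: divg_def lookup_add lookup_deriv_along d1_def d2_def d3_def)

lemma ct_of_int_mult: "ct (of_int n * P) = of_int n * ct P"
  using pair_of_int_mult[of n P "\<lambda>\<mu>. if \<mu> = 0 then 1 else 0"] by (simp add: pair_delta)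

text \<open>Formally log \<open>Lin\<close>, so that inserting it differentiates with respect to the
  exponent v.\<close>

definition log_unit :: "wt \<Rightarrow> rat" where
  "log_unit \<mu> = ray_log (1, 0, 0) \<mu> + ray_log (0, 1, 0) \<mu> + ray_log (0, 0, 1) \<mu>"

text \<open>The series involves only powers of e^\<alpha>, which the derivation kills.\<close>

lemma ray_log_kernel:
  assumes "Modules.additive d" "d \<alpha> = 0"
  shows "d \<mu> * ray_log \<alpha> \<mu> = 0"
proof (cases "\<exists>n. \<mu> = smul n \<alpha>")
  case True
  then obtain n where "\<mu> = smul n \<alpha>" by blast
  then have "d \<mu> = 0" using assms(2) by (simp only: additive_smul[OF assms(1)])
  then show ?thesis by simp
next
  case False
  then show ?thesis by (simp add: ray_log_outside)
qed

text \<open>After integration by parts the i-th derivation meets only log (1 - x_i), and its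
  denominator is cleared by the factor 1 - x_i of the field.\<close>

lemma pair_divg_log_unit:
  "pair (divg g\<^sub>1 g\<^sub>2 g\<^sub>3 P) log_unit = ct ((g\<^sub>1 * X + g\<^sub>2 * Y + g\<^sub>3 * Z) * P)"
proof -
  have k: "d1 \<mu> * ray_log (0, 1, 0) \<mu> = 0" "d1 \<mu> * ray_log (0, 0, 1) \<mu> = 0"
    "d2 \<mu> * ray_log (1, 0, 0) \<mu> = 0" "d2 \<mu> * ray_log (0, 0, 1) \<mu> = 0"
    "d3 \<mu> * ray_log (1, 0, 0) \<mu> = 0" "d3 \<mu> * ray_log (0, 1, 0) \<mu> = 0" for \<mu>
    by (rule ray_log_kernel, rule additive_d, simp add: d1_def d2_def d3_def)+
  have d: "(\<lambda>\<mu>. d1 \<mu> * log_unit \<mu>) = (\<lambda>\<mu>. d1 \<mu> * ray_log (1, 0, 0) \<mu>)"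
    "(\<lambda>\<mu>. d2 \<mu> * log_unit \<mu>) = (\<lambda>\<mu>. d2 \<mu> * ray_log (0, 1, 0) \<mu>)"
    "(\<lambda>\<mu>. d3 \<mu> * log_unit \<mu>) = (\<lambda>\<mu>. d3 \<mu> * ray_log (0, 0, 1) \<mu>)"
    by (simp_all add: log_unit_def distrib_left k del: mult_eq_0_iff)
  have nz: "(1, 0, 0) \<noteq> (0 :: wt)" "(0, 1, 0) \<noteq> (0 :: wt)" "(0, 0, 1) \<noteq> (0 :: wt)"
    by (simp_all add: zero_prod_def)
  have "pair (\<theta>1 (g\<^sub>1 * ((1 - X) * P))) log_unit = ct (X * (g\<^sub>1 * P))"
    using pair_log_cancel[OF additive_d(1) nz(1), of "g\<^sub>1 * P"]
    by (simp add: pair_deriv_along additive_d d X_def mult.left_commute[of g\<^sub>1]) (simp add: d1_def)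
  moreover have "pair (\<theta>2 (g\<^sub>2 * ((1 - Y) * P))) log_unit = ct (Y * (g\<^sub>2 * P))"
    using pair_log_cancel[OF additive_d(2) nz(2), of "g\<^sub>2 * P"]
    by (simp add: pair_deriv_along additive_d d Y_def mult.left_commute[of g\<^sub>2]) (simp add: d2_def)
  moreover have "pair (\<theta>3 (g\<^sub>3 * ((1 - Z) * P))) log_unit = ct (Z * (g\<^sub>3 * P))"
    using pair_log_cancel[OF additive_d(3) nz(3), of "g\<^sub>3 * P"]
    by (simp add: pair_deriv_along additive_d d Z_def mult.left_commute[of g\<^sub>3]) (simp add: d3_def)
  ultimately show ?thesis
    by (simp add: divg_def pair_add algebra_simps lookup_add)
qed

subsection \<open>Logarithms of ratios\<close>

text \<open>Exponents of Y/X, Z/Y and X/Z, a cyclic orbit of long roots with sum zero.\<close>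

abbreviation "w1 \<equiv> (- 1, 1, 0) :: wt"
abbreviation "w2 \<equiv> (0, - 1, 1) :: wt"
abbreviation "w3 \<equiv> (1, 0, - 1) :: wt"

text \<open>Formally the logarithm of \<open>E (- 1) * Vdm\<close>. The summands are expanded along
  three different rays, which is harmless because they are only added.\<close>

definition log_ratio :: "wt \<Rightarrow> rat" where
  "log_ratio \<mu> = ray_log w1 \<mu> + ray_log w2 \<mu> + ray_log w3 \<mu>"

lemma Vdm_factor: "E (- 1) * Vdm = (1 - emon w1) * (1 - emon w2) * (1 - emon w3)"
  by (simp add: E_def Vdm_def X_def Y_def Z_def algebra_simps mult_single)
    (simp flip: zero_prod_def)

text \<open>The Leibniz rule read backwards: each differentiated logarithm is cleared by its own
  factor in \<open>Vdm_factor\<close>, and the three pieces reassemble to the derivative of the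
  product.\<close>

lemma pair_Vdm_log_ratio:
  assumes "Modules.additive d"
  shows "pair (E (- 1) * Vdm * P) (\<lambda>\<mu>. d \<mu> * log_ratio \<mu>) = ct (deriv_along d (E (- 1) * Vdm) * P)"
proof -
  let ?A = "1 - emon w1" and ?B = "1 - emon w2" and ?C = "1 - emon w3"
  have nz: "w1 \<noteq> 0" "w2 \<noteq> 0" "w3 \<noteq> 0"
    by (simp_all add: zero_prod_def)
  have D: "deriv_along d (1 - emon \<alpha>) * Q = - (Poly_Mapping.single \<alpha> (d \<alpha>) * Q)" for \<alpha> Q
    by (simp add: deriv_along_diff deriv_along_one[OF assms])
  have S: "ct (Poly_Mapping.single \<alpha> c * Q) = c * ct (emon \<alpha> * Q)" for \<alpha> c Q
    by (induction Q rule: poly_mapping_single_induct)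
      (simp_all add: mult_single lookup_single when_def distrib_left lookup_add)
  have c: "pair ((1 - emon \<alpha>) * Q) (\<lambda>\<mu>. d \<mu> * ray_log \<alpha> \<mu>) = ct (deriv_along d (1 - emon \<alpha>) * Q)"
    if "\<alpha> \<noteq> 0" for \<alpha> Q
    unfolding D lookup_uminus S[of \<alpha> "d \<alpha>"] using pair_log_cancel[OF assms that] by simp
  have "pair (E (- 1) * Vdm * P) (\<lambda>\<mu>. d \<mu> * log_ratio \<mu>) =
      pair (?A * (?B * ?C * P)) (\<lambda>\<mu>. d \<mu> * ray_log w1 \<mu>)
      + pair (?B * (?A * ?C * P)) (\<lambda>\<mu>. d \<mu> * ray_log w2 \<mu>)
      + pair (?C * (?A * ?B * P)) (\<lambda>\<mu>. d \<mu> * ray_log w3 \<mu>)"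
    unfolding Vdm_factor log_ratio_def distrib_left
    by (simp only: pair_add_right mult_ac)
  also have "\<dots> = ct (deriv_along d ?A * (?B * ?C * P) + deriv_along d ?B * (?A * ?C * P)
      + deriv_along d ?C * (?A * ?B * P))"
    by (simp only: c[OF nz(1)] c[OF nz(2)] c[OF nz(3)] lookup_add)
  also have "deriv_along d ?A * (?B * ?C * P) + deriv_along d ?B * (?A * ?C * P)
      + deriv_along d ?C * (?A * ?B * P) = deriv_along d (E (- 1) * Vdm) * P"
    unfolding Vdm_factor by (simp only: deriv_along_mult[OF assms] distrib_left distrib_right mult_ac add_ac)
  finally show ?thesis .
qed

text \<open>For u > 0 one factor \<open>E (- 1) * Vdm\<close> of \<open>Phi\<close> can be spent on
  the logarithms; what remains is a constant term of a multiple of the same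
  \<open>Phi\<close>.\<close>

lemma pair_divg_log_ratio:
  assumes "g\<^sub>1 * (1 - X) * \<theta>1 Vdm + g\<^sub>2 * (1 - Y) * \<theta>2 Vdm + g\<^sub>3 * (1 - Z) * \<theta>3 Vdm = c * Vdm"
    and "u > 0"
  shows "pair (divg g\<^sub>1 g\<^sub>2 g\<^sub>3 (Phi u v q)) log_ratio =
    - ct ((c - (g\<^sub>1 * (1 - X) + g\<^sub>2 * (1 - Y) + g\<^sub>3 * (1 - Z))) * Phi u v q)"
proof -
  obtain n where n: "u = Suc n" using \<open>u > 0\<close> gr0_implies_Suc by blast
  define P where "P = E (- q - int n) * Lin ^ v * Vdm ^ n"
  have "- q - int u = - 1 + (- q - int n)" by (simp add: n)
  then have "E (- q - int u) = E (- 1) * E (- q - int n)" by (simp only: E_add)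
  then have Phi: "Phi u v q = E (- 1) * Vdm * P"
    by (simp add: Phi_def P_def n algebra_simps)
  \<comment> \<open>The summand \<open>- Vdm\<close> comes from differentiating
    \<open>E (- 1)\<close>.\<close>
  have \<theta>V: "\<theta>1 (E (- 1) * Vdm) = E (- 1) * (\<theta>1 Vdm - Vdm)"
    "\<theta>2 (E (- 1) * Vdm) = E (- 1) * (\<theta>2 Vdm - Vdm)"
    "\<theta>3 (E (- 1) * Vdm) = E (- 1) * (\<theta>3 Vdm - Vdm)"
    by (simp_all add: \<theta>_mult \<theta>_E algebra_simps)
  have "pair (divg g\<^sub>1 g\<^sub>2 g\<^sub>3 (E (- 1) * Vdm * P)) log_ratio =
      - (pair (E (- 1) * Vdm * (g\<^sub>1 * (1 - X) * P)) (\<lambda>\<mu>. d1 \<mu> * log_ratio \<mu>)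
       + pair (E (- 1) * Vdm * (g\<^sub>2 * (1 - Y) * P)) (\<lambda>\<mu>. d2 \<mu> * log_ratio \<mu>)
       + pair (E (- 1) * Vdm * (g\<^sub>3 * (1 - Z) * P)) (\<lambda>\<mu>. d3 \<mu> * log_ratio \<mu>))"
    unfolding divg_def pair_add additive_d[THEN pair_deriv_along] by (simp only: mult_ac minus_add_distrib add_ac)
  also have "\<dots> = - ct (E (- 1) * (\<theta>1 Vdm - Vdm) * (g\<^sub>1 * (1 - X) * P)
      + E (- 1) * (\<theta>2 Vdm - Vdm) * (g\<^sub>2 * (1 - Y) * P) + E (- 1) * (\<theta>3 Vdm - Vdm) * (g\<^sub>3 * (1 - Z) * P))"
    by (simp only: additive_d[THEN pair_Vdm_log_ratio] \<theta>V lookup_add)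
  also have "E (- 1) * (\<theta>1 Vdm - Vdm) * (g\<^sub>1 * (1 - X) * P)
      + E (- 1) * (\<theta>2 Vdm - Vdm) * (g\<^sub>2 * (1 - Y) * P) + E (- 1) * (\<theta>3 Vdm - Vdm) * (g\<^sub>3 * (1 - Z) * P) =
      E (- 1) * P * (g\<^sub>1 * (1 - X) * \<theta>1 Vdm + g\<^sub>2 * (1 - Y) * \<theta>2 Vdm + g\<^sub>3 * (1 - Z) * \<theta>3 Vdm
        - (g\<^sub>1 * (1 - X) + g\<^sub>2 * (1 - Y) + g\<^sub>3 * (1 - Z)) * Vdm)"
    by (simp add: algebra_simps)
  also have "\<dots> = (c - (g\<^sub>1 * (1 - X) + g\<^sub>2 * (1 - Y) + g\<^sub>3 * (1 - Z))) * (E (- 1) * Vdm * P)"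
    unfolding assms(1) by (simp add: algebra_simps)
  finally show ?thesis unfolding Phi .
qed

definition swap :: "wt \<Rightarrow> wt" where "swap \<mu> = (fst (snd \<mu>), fst \<mu>, snd (snd \<mu>))"

lemma additive_swap: "Modules.additive swap"
  by (auto simp: Modules.additive_def swap_def)

lemma push_swap [simp]: "push swap X = Y" "push swap Y = X" "push swap Z = Z" "push swap (E n) = E n"
  by (simp_all add: X_def Y_def Z_def E_def swap_def)

text \<open>Exchanging X and Y preserves constant terms but reverses the sign of \<open>Vdm\<close>,
  hence that of \<open>Phi\<close> for odd u.\<close>

lemma ct_symmetric_Phi_odd:
  assumes "push swap g = g" "odd u"
  shows "ct (g * Phi u v q) = 0"
proof -
  have V: "push swap Vdm = - Vdm"
    unfolding Vdm_def push_mult[OF additive_swap] push_diff push_swap by (simp add: algebra_simps)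
  have L: "push swap Lin = Lin"
    unfolding Lin_def push_mult[OF additive_swap] push_one[OF additive_swap] push_diff push_swap by (simp add: algebra_simps)
  have "push swap (g * Phi u v q) = - (g * Phi u v q)"
    unfolding Phi_def push_mult[OF additive_swap] push_power[OF additive_swap] V L push_swap assms(1)
    using assms(2) by simp
  then have "pair (push swap (g * Phi u v q)) (\<lambda>\<mu>. if \<mu> = 0 then 1 else 0) = - ct (g * Phi u v q)"
    by (simp only: pair_uminus pair_delta lookup_uminus)
  moreover have "(\<lambda>\<mu>. if swap \<mu> = 0 then 1 else 0 :: rat) = (\<lambda>\<mu>. if \<mu> = 0 then 1 else 0)"
    by (auto simp: swap_def zero_prod_def)
  ultimately have "pair (g * Phi u v q) (\<lambda>\<mu>. if \<mu> = 0 then 1 else 0) = - ct (g * Phi u v q)"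
    by (simp only: pair_push[OF additive_swap])
  then show ?thesis
    by (simp add: pair_delta)
qed

subsection \<open>Solving the recursion\<close>

text \<open>
  The summand \<open>(-x)\<^sub>q (-x-s)\<^sub>q (-x-t)\<^sub>q / (q! (1+s)\<^sub>q (1+t)\<^sub>q)\<close> of a well-poised
  hypergeometric series, as a polynomial in \<open>x\<close>.
\<close>

primrec dixon_term :: "rat \<Rightarrow> rat \<Rightarrow> nat \<Rightarrow> rat poly" where
  "dixon_term s t 0 = 1"
| "dixon_term s t (Suc q) =
     smult (1 / ((of_nat q + 1) * (of_nat q + 1 + s) * (of_nat q + 1 + t)))
       ([:of_nat q, - 1:] * [:of_nat q - s, - 1:] * [:of_nat q - t, - 1:] * dixon_term s t q)"

lemma poly_dixon_term_Suc:
  "poly (dixon_term s t (Suc q)) x =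
     (of_nat q - x) * (of_nat q - s - x) * (of_nat q - t - x) * poly (dixon_term s t q) x /
     ((of_nat q + 1) * (of_nat q + 1 + s) * (of_nat q + 1 + t))"
  unfolding dixon_term.simps poly_smult poly_mult poly_pCons by simp

lemma poly_pderiv_dixon_term_Suc:
  "poly (pderiv (dixon_term s t (Suc q))) x =
     ((of_nat q - x) * (of_nat q - s - x) * (of_nat q - t - x) * poly (pderiv (dixon_term s t q)) x
      - ((of_nat q - s - x) * (of_nat q - x) + (of_nat q - t - x) * (of_nat q - x)
         + (of_nat q - t - x) * (of_nat q - s - x)) * poly (dixon_term s t q) x) /
     ((of_nat q + 1) * (of_nat q + 1 + s) * (of_nat q + 1 + t))"
proof -
  have lin: "poly (pderiv [:c, - 1:]) x = - 1" for c :: rat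
    by (simp add: pderiv_pCons)
  have *: "poly (pderiv ([:a, - 1:] * [:b, - 1:] * [:c, - 1:] * P)) x =
      (a - x) * (b - x) * (c - x) * poly (pderiv P) x
      - ((b - x) * (a - x) + (c - x) * (a - x) + (c - x) * (b - x)) * poly P x" for a b c and P :: "rat poly"
    unfolding pderiv_mult poly_add poly_mult lin poly_pCons by (simp add: algebra_simps)
  show ?thesis
    unfolding dixon_term.simps pderiv_smult poly_smult * by simp
qed

declare dixon_term.simps(2) [simp del]

text \<open>The parameters s = u/2 and t = u are the ones that the coefficients of the three
  divergences produce.\<close>

abbreviation \<tau> :: "nat \<Rightarrow> nat \<Rightarrow> rat poly" where
  "\<tau> u \<equiv> dixon_term (of_nat u / 2) (of_nat u)"

section \<open>The homogeneous recursion\<close>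

lemma aomoto_relations:
  fixes F :: "wt \<Rightarrow> rat" and q :: int and u v :: nat
  defines "m \<equiv> \<lambda>g. pair (g * Phi u v q) F"
  shows "of_int (q - 1 - int v - int u) * m e1 - of_int (3 * q) * m 1 =
           pair (divg 1 1 1 (Phi u v q)) F"
    and "of_int (2 * q - 2 - 2 * int v - int u) * m e2 - of_int (2 * q + int u) * m e1 =
           pair (divg (Y + Z) (Z + X) (X + Y) (Phi u v q)) F"
    and "of_int (3 * q - 3 - 3 * int v) * m e3 - of_int (q + int u) * m e2 =
           pair (divg (Y * Z) (Z * X) (X * Y) (Phi u v q)) F"
  unfolding m_def divg_Phi_1 divg_Phi_2 divg_Phi_3
  by (simp_all only: pair_diff pair_of_int_mult mult_1)

text \<open>What Aomoto's argument uses about an insertion. It holds for the insertion 1 and, when u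
  is odd, for \<open>log_ratio\<close>.\<close>

definition divergence_free :: "nat \<Rightarrow> (wt \<Rightarrow> rat) \<Rightarrow> bool" where
  "divergence_free u F \<longleftrightarrow> (\<forall>v q. pair (divg 1 1 1 (Phi u v q)) F = 0
     \<and> pair (divg (Y + Z) (Z + X) (X + Y) (Phi u v q)) F = 0
     \<and> pair (divg (Y * Z) (Z * X) (X * Y) (Phi u v q)) F = 0)"

lemma divergence_freeD:
  assumes "divergence_free u F"
  shows "of_int (q - 1 - int v - int u) * pair (e1 * Phi u v q) F = of_int (3 * q) * pair (Phi u v q) F"
    and "of_int (2 * q - 2 - 2 * int v - int u) * pair (e2 * Phi u v q) F =
           of_int (2 * q + int u) * pair (e1 * Phi u v q) F"
    and "of_int (3 * q - 3 - 3 * int v) * pair (Phi u v (q - 1)) F =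
           of_int (q + int u) * pair (e2 * Phi u v q) F"
  using aomoto_relations[of q v u F] assms
  unfolding divergence_free_def e3_Phi mult_1 by simp_all

text \<open>Follows the chain from e_0 to e_3. For q \<le> 0 the coefficients on the left are
  negative, hence invertible, and the first right side is 0: by assumption, or through its factor 3
  q when q = 0.\<close>

lemma pair_Phi_nonpos:
  assumes "divergence_free u F" and "q \<le> 0" and "q = 0 \<or> pair (Phi u v q) F = 0"
  shows "pair (e1 * Phi u v q) F = 0" "pair (e2 * Phi u v q) F = 0" "pair (Phi u v (q - 1)) F = 0"
proof -
  have nz: "q - 1 - int v - int u \<noteq> 0" "2 * q - 2 - 2 * int v - int u \<noteq> 0" "3 * q - 3 - 3 * int v \<noteq> 0"
    using assms(2) by linarith+
  have "of_int (q - 1 - int v - int u) * pair (e1 * Phi u v q) F = 0"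
    using divergence_freeD(1)[OF assms(1), of q v] assms(3) by auto
  then show 1: "pair (e1 * Phi u v q) F = 0"
    using nz(1) by (simp only: mult_eq_0_iff of_int_eq_0_iff simp_thms)
  have "of_int (2 * q - 2 - 2 * int v - int u) * pair (e2 * Phi u v q) F = 0"
    using divergence_freeD(2)[OF assms(1), of q v] 1 by simp
  then show 2: "pair (e2 * Phi u v q) F = 0"
    using nz(2) by (simp only: mult_eq_0_iff of_int_eq_0_iff simp_thms)
  have "of_int (3 * q - 3 - 3 * int v) * pair (Phi u v (q - 1)) F = 0"
    using divergence_freeD(3)[OF assms(1), of q v] 2 by simp
  then show "pair (Phi u v (q - 1)) F = 0"
    using nz(3) by (simp only: mult_eq_0_iff of_int_eq_0_iff simp_thms)
qed

lemma pair_Phi_neg: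
  assumes "divergence_free u F" and "q < 0"
  shows "pair (Phi u v q) F = 0"
proof -
  have "pair (Phi u v (- int n - 1)) F = 0" for n
  proof (induction n)
    case 0
    show ?case using pair_Phi_nonpos(3)[OF assms(1), of 0 v] by simp
  next
    case (Suc n)
    have "- int (Suc n) = - int n - 1" by simp
    then show ?case
      using pair_Phi_nonpos(3)[OF assms(1), of "- int n - 1" v] Suc by simp
  qed
  from this[of "nat (- q - 1)"] show ?thesis using \<open>q < 0\<close> by simp
qed

lemma pair_Phi_Suc_zero:
  "pair (Phi u (Suc v) 0) F =
    pair (Phi u v 0) F - pair (e1 * Phi u v 0) F + pair (e2 * Phi u v 0) F - pair (Phi u v (0 - 1)) F"
  unfolding Lin_Phi left_diff_distrib distrib_right mult_1 pair_diff pair_add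
  by (simp add: e3_Phi flip: pair_add distrib_right)

text \<open>At q = 0 only the term 1 of \<open>1 - e1 + e2 - e3\<close> contributes, so a further
  factor \<open>Lin\<close> changes nothing.\<close>

lemma pair_Phi_zero:
  assumes "divergence_free u F"
  shows "pair (Phi u v 0) F = pair (Phi u 0 0) F"
proof (induction v)
  case (Suc v)
  have "pair (Phi u (Suc v) 0) F = pair (Phi u v 0) F"
    unfolding pair_Phi_Suc_zero using pair_Phi_nonpos[OF assms, of 0 v] by simp
  with Suc show ?case by simp
qed simp

text \<open>For positive q the chain is solved for the insertion of e_0; its coefficients give the
  ratio of successive Dixon summands.\<close>

lemma pair_Phi_eq:
  assumes "divergence_free u F"
  shows "pair (Phi u v (int n)) F = poly (\<tau> u n) (of_nat v) * pair (Phi u 0 0) F"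
proof (induction n)
  case 0
  show ?case using pair_Phi_zero[OF assms, of v] by simp
next
  case (Suc n)
  let ?a1 = "of_nat n - of_nat v - of_nat u :: rat" and ?a2 = "2 * of_nat n - 2 * of_nat v - of_nat u :: rat"
    and ?a3 = "3 * of_nat n - 3 * of_nat v :: rat"
  let ?b1 = "3 * (of_nat n + 1) :: rat" and ?b2 = "2 * (of_nat n + 1) + of_nat u :: rat"
    and ?b3 = "of_nat n + 1 + of_nat u :: rat"
  let ?q = "int (Suc n)"
  note R = divergence_freeD[OF assms, of ?q v]
  have c: "of_int (?q - 1 - int v - int u) = ?a1" "of_int (3 * ?q) = ?b1"
    "of_int (2 * ?q - 2 - 2 * int v - int u) = ?a2" "of_int (2 * ?q + int u) = ?b2"
    "of_int (3 * ?q - 3 - 3 * int v) = ?a3" "of_int (?q + int u) = ?b3" "?q - 1 = int n"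
    by simp_all
  have R1: "?a1 * pair (e1 * Phi u v ?q) F = ?b1 * pair (Phi u v ?q) F"
    and R2: "?a2 * pair (e2 * Phi u v ?q) F = ?b2 * pair (e1 * Phi u v ?q) F"
    and R3: "?a3 * pair (Phi u v (int n)) F = ?b3 * pair (e2 * Phi u v ?q) F"
    by (rule R(1)[unfolded c(1,2)], rule R(2)[unfolded c(3,4)], rule R(3)[unfolded c(5,6,7)])
  have "?b1 * ?b2 * ?b3 * pair (Phi u v ?q) F = ?a1 * ?a2 * ?a3 * pair (Phi u v (int n)) F"
  proof -
    have "?b1 * ?b2 * ?b3 * pair (Phi u v ?q) F = ?b2 * ?b3 * (?b1 * pair (Phi u v ?q) F)" by (simp only: mult_ac)
    also have "\<dots> = ?a1 * ?b3 * (?b2 * pair (e1 * Phi u v ?q) F)" unfolding R1[symmetric] by (simp only: mult_ac)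
    also have "\<dots> = ?a1 * ?a2 * (?b3 * pair (e2 * Phi u v ?q) F)" unfolding R2[symmetric] by (simp only: mult_ac)
    also have "\<dots> = ?a1 * ?a2 * ?a3 * pair (Phi u v (int n)) F" unfolding R3[symmetric] by (simp only: mult_ac)
    finally show ?thesis .
  qed
  moreover have "0 < ?b1" "0 < ?b2" "0 < ?b3"
    by (simp_all add: add_pos_nonneg add_nonneg_pos)
  then have "?b1 * ?b2 * ?b3 \<noteq> 0" by simp
  ultimately have "pair (Phi u v ?q) F = ?a1 * ?a2 * ?a3 / (?b1 * ?b2 * ?b3) * pair (Phi u v (int n)) F"
    by (metis nonzero_mult_div_cancel_left times_divide_eq_left)
  also have "?a1 * ?a2 * ?a3 / (?b1 * ?b2 * ?b3) =
      (of_nat n - of_nat v) * (of_nat n - of_nat u / 2 - of_nat v) * (of_nat n - of_nat u - of_nat v) /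
      ((of_nat n + 1) * (of_nat n + 1 + of_nat u / 2) * (of_nat n + 1 + of_nat u))"
  proof -
    \<comment> \<open>The 6 is the product of the coefficients 3 and 2 of the linear factors, the
      same on both sides.\<close>
    have "?a1 * ?a2 * ?a3 = 6 * ((of_nat n - of_nat v) * (of_nat n - of_nat u / 2 - of_nat v) * (of_nat n - of_nat u - of_nat v))"
      "?b1 * ?b2 * ?b3 = 6 * ((of_nat n + 1) * (of_nat n + 1 + of_nat u / 2) * (of_nat n + 1 + of_nat u))"
      by (simp_all add: field_simps)
    then show ?thesis by (simp only: mult_divide_mult_cancel_left) 
  qed
  finally show ?case
    unfolding Suc.IH poly_dixon_term_Suc by simp
qed

lemma divergence_free_delta: "divergence_free u (\<lambda>\<mu>. if \<mu> = 0 then 1 else 0)"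
  by (simp add: divergence_free_def pair_delta ct_divg)

lemmas ct_Phi_eq = pair_Phi_eq[OF divergence_free_delta, unfolded pair_delta]

text \<open>The defects in \<open>pair_divg_log_ratio\<close> are constant terms of symmetric
  multiples of \<open>Phi\<close>, which vanish by antisymmetry.\<close>

lemma divergence_free_log_ratio:
  assumes "odd u"
  shows "divergence_free u log_ratio"
proof -
  have u: "u > 0" using assms by (cases u) auto
  have sym: "push swap e1 = e1" "push swap e2 = e2"
    by (simp_all add: push_add push_mult additive_swap algebra_simps)
  have z: "ct ((of_int a * e1 + of_int b * e2) * Phi u v q) = 0" for a b v q
    using ct_symmetric_Phi_odd[OF sym(1) assms, of v q] ct_symmetric_Phi_odd[OF sym(2) assms, of v q]
    by (simp only: distrib_right[of _ _ "Phi u v q"] lookup_add mult.assoc ct_of_int_mult)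
  have c: "3 - 2 * e1 - (1 * (1 - X) + 1 * (1 - Y) + 1 * (1 - Z)) = of_int (- 1) * e1 + of_int 0 * e2"
    "e1 - 3 * e2 - ((Y + Z) * (1 - X) + (Z + X) * (1 - Y) + (X + Y) * (1 - Z)) =
      of_int (- 1) * e1 + of_int (- 1) * e2"
    "- 3 * e3 - (Y * Z * (1 - X) + Z * X * (1 - Y) + X * Y * (1 - Z)) = of_int 0 * e1 + of_int (- 1) * e2"
    by (simp_all add: algebra_simps)
  have "pair (divg 1 1 1 (Phi u v q)) log_ratio = 0"
    "pair (divg (Y + Z) (Z + X) (X + Y) (Phi u v q)) log_ratio = 0"
    "pair (divg (Y * Z) (Z * X) (X * Y) (Phi u v q)) log_ratio = 0" for v q
    unfolding \<theta>_Vdm_symmetric[THEN pair_divg_log_ratio, OF u] c z by simp_all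
  then show ?thesis
    unfolding divergence_free_def by blast
qed

section \<open>The recursion with \<open>log_unit\<close> inserted\<close>

lemma log_unit_relations:
  shows "of_int (q - 1 - int v - int u) * pair (e1 * Phi u v q) log_unit
           = of_int (3 * q) * pair (Phi u v q) log_unit + ct (e1 * Phi u v q)"
    and "of_int (2 * q - 2 - 2 * int v - int u) * pair (e2 * Phi u v q) log_unit
           = of_int (2 * q + int u) * pair (e1 * Phi u v q) log_unit + 2 * ct (e2 * Phi u v q)"
    and "of_int (3 * q - 3 - 3 * int v) * pair (Phi u v (q - 1)) log_unit
           = of_int (q + int u) * pair (e2 * Phi u v q) log_unit + 3 * ct (Phi u v (q - 1))"
proof -
  \<comment> \<open>The sum of the g_i x_i is r e_r for r = 1, 2, 3.\<close>
  have eqs: "1 * X + 1 * Y + 1 * Z = of_int 1 * e1" "(Y + Z) * X + (Z + X) * Y + (X + Y) * Z = of_int 2 * e2"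
    "(Y * Z) * X + (Z * X) * Y + (X * Y) * Z = of_int 3 * e3"
    by (simp_all add: algebra_simps)
  show "of_int (q - 1 - int v - int u) * pair (e1 * Phi u v q) log_unit
           = of_int (3 * q) * pair (Phi u v q) log_unit + ct (e1 * Phi u v q)"
    "of_int (2 * q - 2 - 2 * int v - int u) * pair (e2 * Phi u v q) log_unit
           = of_int (2 * q + int u) * pair (e1 * Phi u v q) log_unit + 2 * ct (e2 * Phi u v q)"
    "of_int (3 * q - 3 - 3 * int v) * pair (Phi u v (q - 1)) log_unit
           = of_int (q + int u) * pair (e2 * Phi u v q) log_unit + 3 * ct (Phi u v (q - 1))"
    using aomoto_relations[of q v u log_unit]
    unfolding pair_divg_log_unit eqs mult.assoc[of _ _ "Phi u v q"] ct_of_int_mult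
    unfolding mult.assoc[symmetric] e3_Phi mult_1 of_int_1 by simp_all
qed

text \<open>The argument of \<open>pair_Phi_nonpos\<close> again; the inhomogeneous terms are plain
  constant terms, to which that lemma itself applies.\<close>

lemma pair_log_unit_nonpos:
  assumes "q \<le> 0" and "q = 0 \<or> pair (Phi u v q) log_unit = 0"
  shows "pair (e1 * Phi u v q) log_unit = 0" "pair (e2 * Phi u v q) log_unit = 0"
    "pair (Phi u v (q - 1)) log_unit = 0"
proof -
  have nz: "q - 1 - int v - int u \<noteq> 0" "2 * q - 2 - 2 * int v - int u \<noteq> 0" "3 * q - 3 - 3 * int v \<noteq> 0"
    using assms(1) by linarith+
  have "q = 0 \<or> pair (Phi u v q) (\<lambda>\<mu>. if \<mu> = 0 then 1 else 0) = 0"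
    using pair_Phi_neg[OF divergence_free_delta, of q u v] assms(1) by linarith
  note ct0 = pair_Phi_nonpos[OF divergence_free_delta assms(1) this, unfolded pair_delta]
  have "of_int (q - 1 - int v - int u) * pair (e1 * Phi u v q) log_unit = 0"
    using log_unit_relations(1)[of q v u] ct0 assms(2) by auto
  then show 1: "pair (e1 * Phi u v q) log_unit = 0"
    using nz(1) by (simp only: mult_eq_0_iff of_int_eq_0_iff simp_thms)
  have "of_int (2 * q - 2 - 2 * int v - int u) * pair (e2 * Phi u v q) log_unit = 0"
    using log_unit_relations(2)[of q v u] ct0 1 by simp
  then show 2: "pair (e2 * Phi u v q) log_unit = 0"
    using nz(2) by (simp only: mult_eq_0_iff of_int_eq_0_iff simp_thms)
  have "of_int (3 * q - 3 - 3 * int v) * pair (Phi u v (q - 1)) log_unit = 0"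
    using log_unit_relations(3)[of q v u] ct0 2 by simp
  then show "pair (Phi u v (q - 1)) log_unit = 0"
    using nz(3) by (simp only: mult_eq_0_iff of_int_eq_0_iff simp_thms)
qed

lemma pair_log_unit_neg:
  assumes "q < 0"
  shows "pair (Phi u v q) log_unit = 0"
proof -
  have "pair (Phi u v (- int n - 1)) log_unit = 0" for n
  proof (induction n)
    case 0
    show ?case using pair_log_unit_nonpos(3)[of 0 u v] by simp
  next
    case (Suc n)
    have "- int (Suc n) = - int n - 1" by simp
    then show ?case
      using pair_log_unit_nonpos(3)[of "- int n - 1" u v] Suc by simp
  qed
  from this[of "nat (- q - 1)"] show ?thesis using \<open>q < 0\<close> by simp
qed

lemma pair_log_unit_zero: "pair (Phi u v 0) log_unit = pair (Phi u 0 0) log_unit"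
proof (induction v)
  case (Suc v)
  have "pair (Phi u (Suc v) 0) log_unit = pair (Phi u v 0) log_unit"
    unfolding pair_Phi_Suc_zero using pair_log_unit_nonpos[of 0 u v] by simp
  with Suc show ?case by simp
qed simp

text \<open>The inhomogeneous relations are formally the v-derivatives of the homogeneous ones.
  Hence the solution is the product rule applied to \<open>pair_Phi_eq\<close>, with
  \<open>pair (Phi u 0 0) log_unit\<close> in the role of the derivative of the initial
  value.\<close>

lemma pair_log_unit_eq:
  "pair (Phi u v (int n)) log_unit =
     poly (pderiv (\<tau> u n)) (of_nat v) * ct (Phi u 0 0) + poly (\<tau> u n) (of_nat v) * pair (Phi u 0 0) log_unit"
proof (induction n)
  case 0
  show ?case using pair_log_unit_zero[of u v] by simp
next
  case (Suc n)
  define a1 a2 a3 b1 b2 b3 :: rat where "a1 = of_nat n - of_nat v - of_nat u"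
    and "a2 = 2 * of_nat n - 2 * of_nat v - of_nat u" and "a3 = 3 * of_nat n - 3 * of_nat v"
    and "b1 = 3 * (of_nat n + 1)" and "b2 = 2 * (of_nat n + 1) + of_nat u"
    and "b3 = of_nat n + 1 + of_nat u"
  note defs = a1_def a2_def a3_def b1_def b2_def b3_def
  let ?q = "int (Suc n)"
  have c: "of_int (?q - 1 - int v - int u) = a1" "of_int (3 * ?q) = b1"
    "of_int (2 * ?q - 2 - 2 * int v - int u) = a2" "of_int (2 * ?q + int u) = b2"
    "of_int (3 * ?q - 3 - 3 * int v) = a3" "of_int (?q + int u) = b3" "?q - 1 = int n"
    by (simp_all add: defs)
  define m0 m1 m2 m3 where "m0 = ct (Phi u v ?q)" and "m1 = ct (e1 * Phi u v ?q)"
    and "m2 = ct (e2 * Phi u v ?q)" and "m3 = ct (Phi u v (int n))"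
  define n0 n1 n2 n3 where "n0 = pair (Phi u v ?q) log_unit" and "n1 = pair (e1 * Phi u v ?q) log_unit"
    and "n2 = pair (e2 * Phi u v ?q) log_unit" and "n3 = pair (Phi u v (int n)) log_unit"
  note mdefs = m0_def m1_def m2_def m3_def n0_def n1_def n2_def n3_def
  have R: "a2 * m2 = b2 * m1" "a3 * m3 = b3 * m2"
    using divergence_freeD[OF divergence_free_delta, of ?q v u, unfolded pair_delta]
    unfolding mdefs by (simp_all only: c)
  have R': "a1 * n1 = b1 * n0 + m1" "a2 * n2 = b2 * n1 + 2 * m2" "a3 * n3 = b3 * n2 + 3 * m3"
    unfolding mdefs
    by (rule log_unit_relations(1)[of ?q v u, unfolded c(1,2)],
        rule log_unit_relations(2)[of ?q v u, unfolded c(3,4)],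
        rule log_unit_relations(3)[of ?q v u, unfolded c(5,6,7)])
  \<comment> \<open>Elimination along the chain. As \<open>a1\<close>, \<open>a2\<close>,
    \<open>a3\<close> have v-derivatives -1, -2, -3, the final coefficient of \<open>m3\<close> is
    the v-derivative of \<open>a1 * a2 * a3\<close>.\<close>
  have "b1 * b2 * b3 * n0 = b2 * b3 * (b1 * n0 + m1) - b3 * (b2 * m1)"
    by (simp add: algebra_simps)
  also have "\<dots> = a1 * b3 * (b2 * n1 + 2 * m2) - 2 * a1 * (b3 * m2) - a2 * (b3 * m2)"
    unfolding R'(1)[symmetric] R(1)[symmetric] by (simp add: algebra_simps)
  also have "\<dots> = a1 * a2 * (b3 * n2 + 3 * m3) - 3 * a1 * a2 * m3 - 2 * a1 * a3 * m3 - a2 * a3 * m3"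
    unfolding R'(2)[symmetric] R(2)[symmetric] by (simp add: algebra_simps)
  also have "\<dots> = a1 * a2 * a3 * n3 - (a2 * a3 + 2 * a1 * a3 + 3 * a1 * a2) * m3"
    unfolding R'(3)[symmetric] by (simp add: algebra_simps)
  finally have step: "b1 * b2 * b3 * n0 = a1 * a2 * a3 * n3 - (a2 * a3 + 2 * a1 * a3 + 3 * a1 * a2) * m3" .
  define x y k w :: rat where "x = of_nat v" and "y = of_nat n" and "k = of_nat u" and "w = k / 2"
  define B where "B = (y + 1) * (y + 1 + w) * (y + 1 + k)"
  have "0 \<le> y" "0 \<le> k" by (simp_all add: y_def k_def)
  then have "B \<noteq> 0" by (simp add: B_def w_def add_nonneg_eq_0_iff)
  have ab: "a1 = y - k - x" "a2 = 2 * (y - w - x)" "a3 = 3 * (y - x)" "b1 * b2 * b3 = 6 * B"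
    by (simp_all add: defs x_def y_def k_def w_def B_def field_simps)
  have "B * n0 = (y - x) * (y - w - x) * (y - k - x) * n3
      - ((y - w - x) * (y - x) + (y - k - x) * (y - x) + (y - k - x) * (y - w - x)) * m3"
    using step unfolding ab by (simp add: algebra_simps)
  then have "n0 = ((y - x) * (y - w - x) * (y - k - x) * n3
      - ((y - w - x) * (y - x) + (y - k - x) * (y - x) + (y - k - x) * (y - w - x)) * m3) / B"
    using \<open>B \<noteq> 0\<close> by (simp add: field_simps)
  moreover have "m3 = poly (\<tau> u n) x * ct (Phi u 0 0)"
    unfolding m3_def x_def by (rule ct_Phi_eq)
  moreover have "n3 = poly (pderiv (\<tau> u n)) x * ct (Phi u 0 0) + poly (\<tau> u n) x * pair (Phi u 0 0) log_unit"
    unfolding n3_def x_def by (rule Suc.IH)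
  moreover have "poly (\<tau> u (Suc n)) x = (y - x) * (y - w - x) * (y - k - x) * poly (\<tau> u n) x / B"
    by (simp only: poly_dixon_term_Suc B_def y_def k_def w_def)
  moreover have "poly (pderiv (\<tau> u (Suc n))) x =
      ((y - x) * (y - w - x) * (y - k - x) * poly (pderiv (\<tau> u n)) x
      - ((y - w - x) * (y - x) + (y - k - x) * (y - x) + (y - k - x) * (y - w - x)) * poly (\<tau> u n) x) / B"
    by (simp only: poly_pderiv_dixon_term_Suc B_def y_def k_def w_def)
  moreover have "(p * (d * c + e * l) - r * (e * c)) / B = (p * d - r * e) / B * c + p * e / B * l"
    for p r c d e l
    using \<open>B \<noteq> 0\<close> by (simp add: field_simps)
  ultimately show ?case
    unfolding n0_def[symmetric] x_def[symmetric] by (simp only:)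
qed

section \<open>Dixon's sum and its derivative\<close>

lemma poly_dixon_term_Suc_mult:
  fixes s t x :: rat
  assumes "s \<ge> 0" "t \<ge> 0"
  shows "(of_nat q + 1) * (of_nat q + 1 + s) * (of_nat q + 1 + t) * poly (dixon_term s t (Suc q)) x =
    (of_nat q - x) * (of_nat q - s - x) * (of_nat q - t - x) * poly (dixon_term s t q) x"
proof -
  have nz: "(of_nat q + 1) * (of_nat q + 1 + s) * (of_nat q + 1 + t) \<noteq> 0"
    using assms by (simp add: add_nonneg_eq_0_iff)
  show ?thesis
    unfolding poly_dixon_term_Suc times_divide_eq_right by (rule nonzero_mult_div_cancel_left[OF nz])
qed

text \<open>Pochhammer shifts: -x - (s + 1) = -(x + 1) - s, and likewise for t, so only the factor
  (-x)_q and the denominators change.\<close>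

lemma dixon_term_raise:
  fixes s t x :: rat
  assumes "s \<ge> 0" "t \<ge> 0"
  shows "(x + 1) * (of_nat q + 1 + s) * (of_nat q + 1 + t) * poly (dixon_term (s + 1) (t + 1) q) x =
    (x + 1 - of_nat q) * ((1 + s) * (1 + t)) * poly (dixon_term s t q) (x + 1)"
proof (induction q)
  case (Suc q)
  \<comment> \<open>The induction step only compares ratios of consecutive terms, which is done here
    in abstract letters.\<close>
  have cancel: "z * b' * c' * P' = (x - y) * g * T'"
    if "a * b' * c' * P' = (y - x) * n2 * n3 * A" "a * b * c * T' = n1 * n2 * n3 * B"
      "z * b * c * A = - n1 * g * B" "a * b * c \<noteq> 0"
    for a b c b' c' z g n1 n2 n3 A B P' T' y :: rat
  proof -
    have "a * b * c * (z * b' * c' * P') = z * b * c * (a * b' * c' * P')" by (simp only: mult_ac)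
    also have "\<dots> = (y - x) * n2 * n3 * (z * b * c * A)" unfolding that(1) by (simp only: mult_ac)
    also have "\<dots> = (x - y) * g * (n1 * n2 * n3 * B)" unfolding that(3) by (simp add: algebra_simps)
    also have "\<dots> = a * b * c * ((x - y) * g * T')" unfolding that(2)[symmetric] by (simp only: mult_ac)
    finally show ?thesis using that(4) by (simp only: mult_cancel_left simp_thms)
  qed
  have nz: "(of_nat q + 1) * (of_nat q + 1 + s) * (of_nat q + 1 + t) \<noteq> 0"
    using assms by (simp add: add_nonneg_eq_0_iff)
  have lower: "(x + 1) * (of_nat q + 1 + s) * (of_nat q + 1 + t) * poly (dixon_term (s + 1) (t + 1) q) x =
      - (of_nat q - (x + 1)) * ((1 + s) * (1 + t)) * poly (dixon_term s t q) (x + 1)"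
    using Suc by simp
  have eqs: "of_nat q - s - (x + 1) = of_nat q - (s + 1) - x" "of_nat q - t - (x + 1) = of_nat q - (t + 1) - x"
    by simp_all
  have upper: "(of_nat q + 1) * (of_nat q + 1 + (s + 1)) * (of_nat q + 1 + (t + 1))
      * poly (dixon_term (s + 1) (t + 1) (Suc q)) x =
      (of_nat q - x) * (of_nat q - s - (x + 1)) * (of_nat q - t - (x + 1)) * poly (dixon_term (s + 1) (t + 1) q) x"
    unfolding eqs by (rule poly_dixon_term_Suc_mult) (use assms in simp_all)
  have "(x + 1) * (of_nat q + 1 + (s + 1)) * (of_nat q + 1 + (t + 1))
      * poly (dixon_term (s + 1) (t + 1) (Suc q)) x =
      (x - of_nat q) * ((1 + s) * (1 + t)) * poly (dixon_term s t (Suc q)) (x + 1)"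
    by (rule cancel[OF upper poly_dixon_term_Suc_mult[OF assms] lower nz])
  moreover have "of_nat q + 1 + (s + 1) = of_nat (Suc q) + 1 + s" "of_nat q + 1 + (t + 1) = of_nat (Suc q) + 1 + t"
    "x - of_nat q = x + 1 - of_nat (Suc q)"
    by simp_all
  ultimately show ?case by (simp only:)
qed simp

text \<open>The first factor of each Pochhammer symbol splits off: (-x-2)_(q+1) = -(x+2) (-x-1)_q,
  and similarly for the other two numerators.\<close>

lemma dixon_term_shift:
  fixes s t x :: rat
  assumes "s \<ge> 0" "t \<ge> 0"
  shows "(of_nat q + 1) * (of_nat q + 1 + s) * (of_nat q + 1 + t) * poly (dixon_term s t (Suc q)) (x + 2) =
    - ((x + 2) * (x + 2 + s) * (x + 2 + t)) * poly (dixon_term s t q) (x + 1)"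
proof (induction q)
  case 0
  show ?case
    unfolding poly_dixon_term_Suc_mult[OF assms] by (simp add: algebra_simps)
next
  case (Suc q)
  have cancel: "d * A' = K * B'"
    if "d * A' = n * A" "e * B' = n * B" "e * A = K * B" "e \<noteq> 0"
    for A A' B B' K d e n :: rat
  proof -
    have "e * (d * A') = n * (e * A)" unfolding that(1) by (simp only: mult_ac)
    also have "\<dots> = K * (n * B)" unfolding that(3) by (simp only: mult_ac)
    also have "\<dots> = e * (K * B')" unfolding that(2)[symmetric] by (simp only: mult_ac)
    finally show ?thesis using that(4) by (simp only: mult_cancel_left simp_thms)
  qed
  have nz: "(of_nat q + 1) * (of_nat q + 1 + s) * (of_nat q + 1 + t) \<noteq> 0"
    using assms by (simp add: add_nonneg_eq_0_iff)
  have eqs: "of_nat (Suc q) - (x + 2) = of_nat q - (x + 1)" "of_nat (Suc q) - s - (x + 2) = of_nat q - s - (x + 1)"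
    "of_nat (Suc q) - t - (x + 2) = of_nat q - t - (x + 1)"
    by simp_all
  show ?case
    by (rule cancel[OF poly_dixon_term_Suc_mult[OF assms, of "Suc q" "x + 2", unfolded eqs]
          poly_dixon_term_Suc_mult[OF assms] Suc nz])
qed

text \<open>The multiplier for which the contiguous relation below telescopes. Its zero at x = -1
  provides the start of the odd case.\<close>

definition dixon_coeff :: "rat \<Rightarrow> rat \<Rightarrow> rat poly" where
  "dixon_coeff s t = smult (1 / ((1 + s) * (1 + t))) ([:1, 1:] * [:6 + 2 * s + 2 * t, 3:])"

lemma poly_dixon_coeff:
  "poly (dixon_coeff s t) x = (x + 1) * (6 + 3 * x + 2 * s + 2 * t) / ((1 + s) * (1 + t))"
  unfolding dixon_coeff_def poly_smult poly_mult poly_pCons by (simp add: ac_simps)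

text \<open>
  A contiguous relation of WZ type: it telescopes over \<open>q\<close>, and the boundary term is
  again a Dixon summand.
\<close>

lemma dixon_term_contiguous:
  assumes "s \<ge> 0" "t \<ge> 0"
  shows "poly (dixon_term s t (Suc q)) (x + 2) + poly (dixon_coeff s t) x * poly (dixon_term (s + 1) (t + 1) q) x =
    poly (dixon_term s t (Suc q)) (x + 1) - poly (dixon_term s t q) (x + 1)"
proof -
  define y :: rat where "y = of_nat q"
  have y: "y \<ge> 0" by (simp add: y_def)
  define B where "B = poly (dixon_term s t q) (x + 1)"
  let ?D = "(y + 1) * (y + 1 + s) * (y + 1 + t)"
  have nz: "?D \<noteq> 0" "(1 + s) * (1 + t) \<noteq> 0"
    using assms y by (simp_all add: add_nonneg_eq_0_iff)
  have 1: "?D * poly (dixon_term s t (Suc q)) (x + 2) = - ((x + 2) * (x + 2 + s) * (x + 2 + t)) * B"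
    using dixon_term_shift[OF assms, of q x] unfolding B_def y_def .
  have "?D * (poly (dixon_coeff s t) x * poly (dixon_term (s + 1) (t + 1) q) x) =
      (y + 1) * (6 + 3 * x + 2 * s + 2 * t) / ((1 + s) * (1 + t)) *
      ((x + 1) * (y + 1 + s) * (y + 1 + t) * poly (dixon_term (s + 1) (t + 1) q) x)"
    unfolding poly_dixon_coeff by (simp only: times_divide_eq_left times_divide_eq_right mult_ac)
  also have "\<dots> = (y + 1) * (6 + 3 * x + 2 * s + 2 * t) * (x + 1 - y) * B"
    unfolding dixon_term_raise[OF assms, of x q, folded y_def] B_def
    using nz(2) by (simp only: times_divide_eq_left times_divide_eq_right mult_ac) (simp add: nonzero_divide_eq_eq mult_ac)
  finally have 2: "?D * (poly (dixon_coeff s t) x * poly (dixon_term (s + 1) (t + 1) q) x) =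
      (y + 1) * (6 + 3 * x + 2 * s + 2 * t) * (x + 1 - y) * B" .
  have 3: "?D * poly (dixon_term s t (Suc q)) (x + 1) =
      (y - (x + 1)) * (y - s - (x + 1)) * (y - t - (x + 1)) * B"
    using poly_dixon_term_Suc_mult[OF assms, of q "x + 1"] unfolding B_def y_def .
  \<comment> \<open>With denominators cleared every term is a multiple of \<open>B\<close>, and the
    relation reduces to this polynomial identity.\<close>
  have 4: "- ((x + 2) * (x + 2 + s) * (x + 2 + t)) + (y + 1) * (6 + 3 * x + 2 * s + 2 * t) * (x + 1 - y) =
      (y - (x + 1)) * (y - s - (x + 1)) * (y - t - (x + 1)) - ?D"
    by (simp add: algebra_simps)
  have "?D * (poly (dixon_term s t (Suc q)) (x + 2) + poly (dixon_coeff s t) x * poly (dixon_term (s + 1) (t + 1) q) x) =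
      (- ((x + 2) * (x + 2 + s) * (x + 2 + t)) + (y + 1) * (6 + 3 * x + 2 * s + 2 * t) * (x + 1 - y)) * B"
    unfolding distrib_left[of ?D] 1 2 distrib_right[of _ _ B] ..
  also have "\<dots> = ?D * (poly (dixon_term s t (Suc q)) (x + 1) - B)"
    unfolding 4 right_diff_distrib[of ?D] 3 left_diff_distrib[of _ _ B] ..
  finally show ?thesis
    using nz(1) unfolding B_def by (simp only: mult_cancel_left simp_thms)
qed

text \<open>Truncation keeps the sum a polynomial in x that can be differentiated; at a natural
  number x the summands with q > x vanish.\<close>

definition dixon_sum :: "rat \<Rightarrow> rat \<Rightarrow> nat \<Rightarrow> rat poly" where
  "dixon_sum s t Q = (\<Sum>q<Q. dixon_term s t q)"

text \<open>Once the right side vanishes, as it does at natural x + 1 < Q, this is a two-step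
  recursion in x that raises s and t by one.\<close>

lemma dixon_sum_contiguous:
  assumes "s \<ge> 0" "t \<ge> 0"
  shows "poly (dixon_sum s t (Suc Q)) (x + 2) + poly (dixon_coeff s t) x * poly (dixon_sum (s + 1) (t + 1) Q) x =
    poly (dixon_term s t Q) (x + 1)"
proof (induction Q)
  case 0
  show ?case by (simp add: dixon_sum_def)
next
  case (Suc Q)
  have "poly (dixon_sum s t (Suc (Suc Q))) (x + 2)
      + poly (dixon_coeff s t) x * poly (dixon_sum (s + 1) (t + 1) (Suc Q)) x =
      (poly (dixon_sum s t (Suc Q)) (x + 2) + poly (dixon_coeff s t) x * poly (dixon_sum (s + 1) (t + 1) Q) x)
      + (poly (dixon_term s t (Suc Q)) (x + 2)
         + poly (dixon_coeff s t) x * poly (dixon_term (s + 1) (t + 1) Q) x)"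
    by (simp add: dixon_sum_def algebra_simps)
  then show ?case
    unfolding Suc dixon_term_contiguous[OF assms] by simp
qed

text \<open>The relation holds at every rational x, so it is an identity of polynomials and may be
  differentiated.\<close>

lemma dixon_sum_contiguous_pderiv:
  assumes "s \<ge> 0" "t \<ge> 0"
  shows "poly (pderiv (dixon_sum s t (Suc Q))) (x + 2)
      + poly (pderiv (dixon_coeff s t)) x * poly (dixon_sum (s + 1) (t + 1) Q) x
      + poly (dixon_coeff s t) x * poly (pderiv (dixon_sum (s + 1) (t + 1) Q)) x =
    poly (pderiv (dixon_term s t Q)) (x + 1)"
proof -
  have "pcompose (dixon_sum s t (Suc Q)) [:2, 1:] + dixon_coeff s t * dixon_sum (s + 1) (t + 1) Q =
      pcompose (dixon_term s t Q) [:1, 1:]" (is "?l = ?r")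
  proof -
    have "poly ?l x = poly ?r x" for x
      using dixon_sum_contiguous[OF assms, of Q x] by (simp add: poly_pcompose add.commute)
    then show ?thesis by (simp add: poly_eq_poly_eq_iff[symmetric] fun_eq_iff)
  qed
  then have "pderiv ?l = pderiv ?r" by simp
  then have "poly (pderiv ?l) x = poly (pderiv ?r) x" by simp
  then show ?thesis
    by (simp add: pderiv_add pderiv_mult pderiv_pcompose poly_pcompose pderiv_pCons algebra_simps)
qed

lemma poly_dixon_term_vanish: "n < Q \<Longrightarrow> poly (dixon_term s t Q) (of_nat n) = 0"
  by (induction Q) (auto simp: less_Suc_eq poly_dixon_term_Suc)

text \<open>At x = n the numerator factors q - x and q - s - x vanish for q = n and q = n + s. Once
  both have occurred the zero is double.\<close>

lemma poly_pderiv_dixon_term_vanish: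
  assumes "n + s < Q"
  shows "poly (pderiv (dixon_term (of_nat s) t Q)) (of_nat n) = 0"
  using assms
proof (induction Q)
  case (Suc Q)
  show ?case
  proof (cases "n + s < Q")
    case True
    then show ?thesis
      using Suc.IH by (simp add: poly_pderiv_dixon_term_Suc poly_dixon_term_vanish)
  next
    case False
    with Suc.prems have Q: "Q = n + s" by simp
    show ?thesis
    proof (cases "s = 0")
      case True
      then show ?thesis by (simp add: Q poly_pderiv_dixon_term_Suc)
    next
      case False
      then have "poly (dixon_term (of_nat s) t Q) (of_nat n) = 0"
        by (intro poly_dixon_term_vanish) (simp add: Q)
      then show ?thesis by (simp add: Q poly_pderiv_dixon_term_Suc)
    qed
  qed
qed simp

text \<open>The two-step recursion, with s and t left free because each step raises them; at x = 0
  only the summand 1 is left.\<close>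

lemma dixon_sum_even:
  fixes s t :: rat
  assumes "s \<ge> 0" "t \<ge> 0" "Q > 2 * m"
  shows "poly (dixon_sum s t Q) (of_nat (2 * m)) =
    (- 1) ^ m * (\<Prod>i<m. 2 * of_nat i + 1) * (\<Prod>i<m. 6 * of_nat m - 2 * of_nat i + 2 * s + 2 * t) /
    ((\<Prod>i<m. 1 + s + of_nat i) * (\<Prod>i<m. 1 + t + of_nat i))"
  using assms
proof (induction m arbitrary: s t Q)
  case 0
  have "poly (dixon_sum s t Q) 0 = poly (dixon_sum s t (Suc 0)) 0"
    unfolding dixon_sum_def poly_sum using \<open>Q > 2 * 0\<close> poly_dixon_term_vanish[of 0 _ s t]
    by (intro sum.mono_neutral_right) auto
  then show ?case by (simp add: dixon_sum_def)
next
  case (Suc m)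
  obtain R where R: "Q = Suc R" using Suc.prems(3) by (cases Q) auto
  have "of_nat (2 * m) + 1 = (of_nat (2 * m + 1) :: rat)" by simp
  moreover have "poly (dixon_term s t R) (of_nat (2 * m + 1)) = 0"
    by (rule poly_dixon_term_vanish) (use Suc.prems(3) R in simp)
  ultimately have "poly (dixon_sum s t Q) (of_nat (2 * m) + 2)
      + poly (dixon_coeff s t) (of_nat (2 * m)) * poly (dixon_sum (s + 1) (t + 1) R) (of_nat (2 * m)) = 0"
    using dixon_sum_contiguous[OF Suc.prems(1,2), of R "of_nat (2 * m)"] unfolding R by (simp only:)
  then have "poly (dixon_sum s t Q) (of_nat (2 * m) + 2) =
      - poly (dixon_coeff s t) (of_nat (2 * m)) * poly (dixon_sum (s + 1) (t + 1) R) (of_nat (2 * m))"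
    by (simp add: eq_neg_iff_add_eq_0)
  moreover have "of_nat (2 * m) + 2 = (of_nat (2 * Suc m) :: rat)" by simp
  ultimately have "poly (dixon_sum s t Q) (of_nat (2 * Suc m)) =
      - ((2 * of_nat m + 1) * (6 * of_nat (Suc m) + 2 * s + 2 * t) / ((1 + s) * (1 + t))) *
      poly (dixon_sum (s + 1) (t + 1) R) (of_nat (2 * m))"
    unfolding poly_dixon_coeff by (simp add: algebra_simps)
  also have "poly (dixon_sum (s + 1) (t + 1) R) (of_nat (2 * m)) =
      (- 1) ^ m * (\<Prod>i<m. 2 * of_nat i + 1) * (\<Prod>i<m. 6 * of_nat m - 2 * of_nat i + 2 * (s + 1) + 2 * (t + 1)) /
      ((\<Prod>i<m. 1 + (s + 1) + of_nat i) * (\<Prod>i<m. 1 + (t + 1) + of_nat i))"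
    by (rule Suc.IH) (use Suc.prems R in simp_all)
  also have "(\<Prod>i<m. 6 * of_nat m - 2 * of_nat i + 2 * (s + 1) + 2 * (t + 1)) =
      (\<Prod>i<m. 6 * of_nat (Suc m) - 2 * of_nat (Suc i) + 2 * s + 2 * t)"
    by (rule prod.cong) simp_all
  also have "(\<Prod>i<m. 1 + (s + 1) + of_nat i) = (\<Prod>i<m. 1 + s + of_nat (Suc i))"
    by (rule prod.cong) simp_all
  also have "(\<Prod>i<m. 1 + (t + 1) + of_nat i) = (\<Prod>i<m. 1 + t + of_nat (Suc i))"
    by (rule prod.cong) simp_all
  finally show ?case
    unfolding prod.lessThan_Suc_shift[of "\<lambda>i. 6 * of_nat (Suc m) - 2 * of_nat i + 2 * s + 2 * t"]
      prod.lessThan_Suc_shift[of "\<lambda>i. 1 + s + of_nat i"] prod.lessThan_Suc_shift[of "\<lambda>i. 1 + t + of_nat i"]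
      prod.lessThan_Suc[of "\<lambda>i. 2 * of_nat i + 1"]
    by (simp add: mult_ac)
qed

text \<open>The same recursion, now started by the relation at x = -1, where its coefficient
  vanishes.\<close>

lemma dixon_sum_odd:
  fixes s t :: rat
  assumes "s \<ge> 0" "t \<ge> 0" "Q > 2 * m + 1"
  shows "poly (dixon_sum s t Q) (of_nat (2 * m + 1)) = 0"
  using assms
proof (induction m arbitrary: s t Q)
  case 0
  obtain R where R: "Q = Suc R" using 0(3) by (cases Q) auto
  have "poly (dixon_term s t R) 0 = 0"
    using poly_dixon_term_vanish[of 0 R s t] 0(3) R by simp
  then show ?case
    using dixon_sum_contiguous[OF 0(1,2), of R "- 1"] unfolding R by (simp add: poly_dixon_coeff)
next
  case (Suc m)
  obtain R where R: "Q = Suc R" using Suc.prems(3) by (cases Q) auto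
  have "poly (dixon_term s t R) (of_nat (2 * m + 2)) = 0"
    by (rule poly_dixon_term_vanish) (use Suc.prems(3) R in simp)
  moreover have "poly (dixon_sum (s + 1) (t + 1) R) (of_nat (2 * m + 1)) = 0"
    by (rule Suc.IH) (use Suc.prems R in simp_all)
  moreover have "of_nat (2 * m + 1) + 2 = (of_nat (2 * Suc m + 1) :: rat)"
    "of_nat (2 * m + 1) + 1 = (of_nat (2 * m + 2) :: rat)" by simp_all
  ultimately show ?case
    using dixon_sum_contiguous[OF Suc.prems(1,2), of R "of_nat (2 * m + 1)"] unfolding R by (simp only:)
qed

subsection \<open>The sum at \<open>x = -1\<close>\<close>

text \<open>The derivative of the coefficient does not vanish at x = -1, so the derivative of the
  sum at x = 1 involves the sum at -1. There a numerator factor q + 1 cancels the one from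
  q!.\<close>

lemma dixon_term_neg1_Suc:
  fixes s t :: rat
  assumes "s \<ge> 0" "t \<ge> 0"
  shows "(of_nat q + 1 + s) * (of_nat q + 1 + t) * poly (dixon_term s t (Suc q)) (- 1) =
    (of_nat q + 1 - s) * (of_nat q + 1 - t) * poly (dixon_term s t q) (- 1)"
proof -
  have "of_nat q - (- 1) = (of_nat q + 1 :: rat)" "of_nat q - s - (- 1) = of_nat q + 1 - s"
    "of_nat q - t - (- 1) = of_nat q + 1 - t" by simp_all
  note poly_dixon_term_Suc_mult[OF assms, of q "- 1", unfolded this mult.assoc]
  moreover have "of_nat q + 1 \<noteq> (0 :: rat)" by (simp add: add_nonneg_eq_0_iff)
  ultimately show ?thesis by (simp only: mult_cancel_left simp_thms mult.assoc)
qed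

lemma dixon_term_neg1_vanish:
  assumes "k < q"
  shows "poly (dixon_term (of_nat k + 1) t q) (- 1) = 0"
  using assms by (induction q) (auto simp: less_Suc_eq poly_dixon_term_Suc)

lemma dixon_term_neg1_raise:
  fixes s t :: rat
  assumes "s \<ge> 0" "t \<ge> 0"
  shows "t * (t + 1) * poly (dixon_term s t q) (- 1) =
    (t - of_nat q) * (t + 1 + of_nat q) * poly (dixon_term s (t + 1) q) (- 1)"
proof (induction q)
  case (Suc q)
  define y :: rat where "y = of_nat q"
  have "y \<ge> 0" by (simp add: y_def)
  define A B where "A = poly (dixon_term s t q) (- 1)" and "B = poly (dixon_term s (t + 1) q) (- 1)"
  define A' B' where "A' = poly (dixon_term s t (Suc q)) (- 1)" and "B' = poly (dixon_term s (t + 1) (Suc q)) (- 1)"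
  have A': "(y + 1 + s) * (y + 1 + t) * A' = (y + 1 - s) * (y + 1 - t) * A"
    using dixon_term_neg1_Suc[OF assms, of q] unfolding y_def A_def A'_def .
  have B': "(y + 1 + s) * (y + 1 + (t + 1)) * B' = (y + 1 - s) * (y + 1 - (t + 1)) * B"
    unfolding y_def B_def B'_def by (rule dixon_term_neg1_Suc) (use assms in simp_all)
  have IH: "t * (t + 1) * A = (t - y) * (t + 1 + y) * B"
    using Suc unfolding y_def A_def B_def .
  have nz: "(y + 1 + s) * (y + 1 + t) \<noteq> 0"
    using assms \<open>y \<ge> 0\<close> by (simp add: add_nonneg_eq_0_iff)
  have "(y + 1 + s) * (y + 1 + t) * (t * (t + 1) * A') = t * (t + 1) * ((y + 1 + s) * (y + 1 + t) * A')"
    by (simp only: mult_ac)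
  also have "\<dots> = (y + 1 - s) * (y + 1 - t) * (t * (t + 1) * A)"
    unfolding A' by (simp only: mult_ac)
  also have "\<dots> = (t - (y + 1)) * (y + 1 + t) * ((y + 1 - s) * (y + 1 - (t + 1)) * B)"
    unfolding IH by (simp add: algebra_simps)
  also have "\<dots> = (y + 1 + s) * (y + 1 + t) * ((t - (y + 1)) * (t + 1 + (y + 1)) * B')"
    unfolding B'[symmetric] by (simp add: algebra_simps)
  finally have "t * (t + 1) * A' = (t - (y + 1)) * (t + 1 + (y + 1)) * B'"
    using nz by (simp only: mult_cancel_left simp_thms)
  then show ?case by (simp add: A'_def B'_def y_def add.commute)
qed simp

text \<open>A recursion in t with telescoping certificate \<open>H\<close>;
  \<open>dixon_term_neg1_raise\<close> expresses both summands through \<open>g'\<close>.\<close>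

lemma dixon_sum_neg1_raise:
  fixes t :: rat
  assumes "t > 0" "k < Q"
  defines "s \<equiv> of_nat k + 1 :: rat"
  shows "(s + t) * (1 + 2 * t) * poly (dixon_sum s (t + 1) Q) (- 1) =
    (2 * s + 2 * t - 1) * (t + 1) * poly (dixon_sum s t Q) (- 1)"
proof -
  have nonneg: "s \<ge> 0" "t \<ge> 0" "t + 1 \<ge> 0" using assms by (simp_all add: s_def)
  define g g' where "g q = poly (dixon_term s t q) (- 1)" and "g' q = poly (dixon_term s (t + 1) q) (- 1)" for q
  define H where "H q = - (of_nat q * (of_nat q + s) * (of_nat q + t + 1) * g' q)" for q
  have tele: "t * (s + t) * (1 + 2 * t) * g' q - (2 * s + 2 * t - 1) * (t * (t + 1) * g q) = H (Suc q) - H q" for q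
  proof -
    define y :: rat where "y = of_nat q"
    have "H (Suc q) = - ((y + 1) * ((y + 1 + s) * (y + 1 + (t + 1)) * g' (Suc q)))"
      by (simp add: H_def y_def mult_ac add_ac)
    also have "(y + 1 + s) * (y + 1 + (t + 1)) * g' (Suc q) = (y + 1 - s) * (y + 1 - (t + 1)) * g' q"
      unfolding y_def g'_def by (rule dixon_term_neg1_Suc[OF nonneg(1,3)])
    finally have 1: "H (Suc q) = - ((y + 1) * ((y + 1 - s) * (y + 1 - (t + 1)) * g' q))" .
    have 2: "H q = - (y * (y + s) * (y + t + 1) * g' q)" by (simp add: H_def y_def)
    have 3: "t * (t + 1) * g q = (t - y) * (t + 1 + y) * g' q"
      unfolding g_def g'_def y_def by (rule dixon_term_neg1_raise[OF nonneg(1,2)])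
    show ?thesis unfolding 1 2 3 by (simp add: algebra_simps)
  qed
  have "(\<Sum>q<Q. H (Suc q) - H q) = H Q - H 0"
    by (rule sum_lessThan_telescope)
  \<comment> \<open>\<open>H 0\<close> vanishes through its factor q, and \<open>H Q\<close> because
    s = k + 1 terminates the series before Q.\<close>
  also have "\<dots> = 0"
    using dixon_term_neg1_vanish[OF assms(2), of "t + 1"] by (simp add: H_def g'_def s_def)
  finally have "0 = (\<Sum>q<Q. t * (s + t) * (1 + 2 * t) * g' q - (2 * s + 2 * t - 1) * (t * (t + 1) * g q))"
    by (simp only: tele)
  also have "\<dots> = t * ((s + t) * (1 + 2 * t) * (\<Sum>q<Q. g' q) - (2 * s + 2 * t - 1) * (t + 1) * (\<Sum>q<Q. g q))"
    unfolding sum_subtractf sum_distrib_left right_diff_distrib[of t] by (simp only: mult.assoc mult.left_commute[of t])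
  finally show ?thesis
    using assms(1) by (simp add: g_def g'_def dixon_sum_def poly_sum)
qed

lemma dfac_simps [simp]: "dfac 0 = 1" "dfac (Suc 0) = 1"
  "dfac (Suc (Suc n)) = (of_nat n + 2) * dfac n"
  by (simp_all add: dfac_def algebra_simps)

lemma dfac_pos: "dfac n > 0"
  by (induction n rule: double_factorial.induct) (simp_all add: add_nonneg_pos)

lemma dfac_nonzero [simp]: "dfac n \<noteq> 0"
  using dfac_pos[of n] by simp

text \<open>Induction on l raises t. At t = 1 the numerator factor q + 1 - t vanishes for q = 0, so
  the sum is 1.\<close>

lemma dixon_sum_neg1:
  assumes "k < Q"
  shows "poly (dixon_sum (of_nat k + 1) (of_nat l + 1) Q) (- 1) =
    dfac (2 * k + 2 * l + 1) * fact (k + 1) * fact (l + 1) /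
    (dfac (2 * k + 1) * dfac (2 * l + 1) * fact (k + l + 1))"
proof (induction l)
  case 0
  have z: "poly (dixon_term (of_nat k + 1) 1 q) (- 1) = 0" if "q \<ge> 1" for q
  proof (use that in \<open>induction q\<close>)
    case (Suc q)
    then show ?case by (cases "q = 0") (simp_all add: poly_dixon_term_Suc)
  qed simp
  have "poly (dixon_sum (of_nat k + 1) 1 Q) (- 1) = poly (dixon_sum (of_nat k + 1) 1 (Suc 0)) (- 1)"
    unfolding dixon_sum_def poly_sum using assms z by (intro sum.mono_neutral_right) auto
  then show ?case by (simp add: dixon_sum_def)
next
  case (Suc l)
  let ?f = "\<lambda>l. poly (dixon_sum (of_nat k + 1) (of_nat l + 1) Q) (- 1)"
  have raise: "(of_nat k + of_nat l + 2) * (2 * of_nat l + 3) * ?f (Suc l) =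
      (2 * of_nat k + 2 * of_nat l + 3) * (of_nat l + 2) * ?f l"
    using dixon_sum_neg1_raise[OF _ assms, of "of_nat l + 1"] by (simp add: algebra_simps)
  have "(of_nat k + of_nat l + 2) * (2 * of_nat l + 3) \<noteq> (0 :: rat)"
    by (simp add: add_nonneg_eq_0_iff)
  then have "?f (Suc l) = (2 * of_nat k + 2 * of_nat l + 3) * (of_nat l + 2) * ?f l /
      ((of_nat k + of_nat l + 2) * (2 * of_nat l + 3))"
    unfolding raise[symmetric] by simp
  then show ?case
    unfolding Suc by (simp add: mult_ac add_ac)
qed

lemma pderiv_dixon_coeff_neg1:
  "poly (pderiv (dixon_coeff s t)) (- 1) = (3 + 2 * s + 2 * t) / ((1 + s) * (1 + t))"
  by (simp add: dixon_coeff_def pderiv_smult pderiv_mult pderiv_pCons flip: diff_divide_distrib)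

text \<open>In the differentiated recursion the derivative of the coefficient multiplies a vanishing
  odd sum, so the step has the shape of the even case. At the start, x = -1, the coefficient is 0
  and its derivative multiplies the sum at -1. The bound on Q makes the boundary derivative
  vanish.\<close>

lemma pderiv_dixon_sum_odd:
  fixes k l :: nat
  assumes "Q > 2 * m + 1 + k"
  shows "poly (pderiv (dixon_sum (of_nat k) (of_nat l) Q)) (of_nat (2 * m + 1)) =
    - ((- 1) ^ m) * dfac (2 * m) * dfac (6 * m + 2 * k + 2 * l + 3) * fact k * fact l /
    (dfac (2 * k + 2 * m + 1) * dfac (2 * l + 2 * m + 1) * fact (k + l + 2 * m + 1))"
  using assms
proof (induction m arbitrary: k l Q)
  case 0
  obtain R where R: "Q = Suc R" using 0 by (cases Q) auto
  have "poly (pderiv (dixon_term (of_nat k) (of_nat l) R)) 0 = 0"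
    using poly_pderiv_dixon_term_vanish[of 0 k R] 0 R by simp
  then have "poly (pderiv (dixon_sum (of_nat k) (of_nat l) Q)) 1 =
      - poly (pderiv (dixon_coeff (of_nat k) (of_nat l))) (- 1)
      * poly (dixon_sum (of_nat k + 1) (of_nat l + 1) R) (- 1)"
    using dixon_sum_contiguous_pderiv[of "of_nat k" "of_nat l" R "- 1"] unfolding R
    by (simp add: poly_dixon_coeff eq_neg_iff_add_eq_0)
  also have "\<dots> = - ((3 + 2 * of_nat k + 2 * of_nat l) / ((1 + of_nat k) * (1 + of_nat l))) *
      (dfac (2 * k + 2 * l + 1) * fact (k + 1) * fact (l + 1) /
      (dfac (2 * k + 1) * dfac (2 * l + 1) * fact (k + l + 1)))"
    unfolding pderiv_dixon_coeff_neg1 using 0 R by (subst dixon_sum_neg1) simp_all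
  also have "fact (k + 1) = (1 + of_nat k) * (fact k :: rat)" by simp
  also have "fact (l + 1) = (1 + of_nat l) * (fact l :: rat)" by simp
  also have "- ((3 + 2 * of_nat k + 2 * of_nat l) / ((1 + of_nat k) * (1 + of_nat l))) *
      (dfac (2 * k + 2 * l + 1) * ((1 + of_nat k) * fact k) * ((1 + of_nat l) * fact l) /
      (dfac (2 * k + 1) * dfac (2 * l + 1) * fact (k + l + 1))) =
      - ((3 + 2 * of_nat k + 2 * of_nat l) * dfac (2 * k + 2 * l + 1)) * fact k * fact l /
      (dfac (2 * k + 1) * dfac (2 * l + 1) * fact (k + l + 1))"
  proof -
    have "1 + of_nat k \<noteq> (0 :: rat)" "1 + of_nat l \<noteq> (0 :: rat)"
      by (simp_all add: add_nonneg_eq_0_iff)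
    then show ?thesis by (simp add: divide_simps)
  qed
  also have "(3 + 2 * of_nat k + 2 * of_nat l) * dfac (2 * k + 2 * l + 1) = dfac (2 * k + 2 * l + 3)"
    by (simp add: eval_nat_numeral(2,3) algebra_simps)
  finally show ?case by simp
next
  case (Suc m)
  obtain R where R: "Q = Suc R" using Suc.prems by (cases Q) auto
  have "poly (pderiv (dixon_term (of_nat k) (of_nat l) R)) (of_nat (2 * m + 2)) = 0"
    by (rule poly_pderiv_dixon_term_vanish) (use Suc.prems R in simp)
  moreover have "poly (dixon_sum (of_nat k + 1) (of_nat l + 1) R) (of_nat (2 * m + 1)) = 0"
    by (rule dixon_sum_odd) (use Suc.prems R in simp_all)
  moreover have "of_nat (2 * m + 1) + 2 = (of_nat (2 * Suc m + 1) :: rat)"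
    "of_nat (2 * m + 1) + 1 = (of_nat (2 * m + 2) :: rat)" by simp_all
  ultimately have "poly (pderiv (dixon_sum (of_nat k) (of_nat l) Q)) (of_nat (2 * Suc m + 1)) +
      poly (dixon_coeff (of_nat k) (of_nat l)) (of_nat (2 * m + 1))
      * poly (pderiv (dixon_sum (of_nat k + 1) (of_nat l + 1) R)) (of_nat (2 * m + 1)) = 0"
    using dixon_sum_contiguous_pderiv[of "of_nat k" "of_nat l" R "of_nat (2 * m + 1)"] unfolding R
    by (simp only: mult_zero_right add_0_right of_nat_0_le_iff simp_thms)
  then have "poly (pderiv (dixon_sum (of_nat k) (of_nat l) Q)) (of_nat (2 * Suc m + 1)) =
      - poly (dixon_coeff (of_nat k) (of_nat l)) (of_nat (2 * m + 1))
      * poly (pderiv (dixon_sum (of_nat (Suc k)) (of_nat (Suc l)) R)) (of_nat (2 * m + 1))"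
    by (simp add: eq_neg_iff_add_eq_0 add.commute)
  also have "poly (pderiv (dixon_sum (of_nat (Suc k)) (of_nat (Suc l)) R)) (of_nat (2 * m + 1)) =
    - ((- 1) ^ m) * dfac (2 * m) * dfac (6 * m + 2 * Suc k + 2 * Suc l + 3) * fact (Suc k) * fact (Suc l) /
    (dfac (2 * Suc k + 2 * m + 1) * dfac (2 * Suc l + 2 * m + 1) * fact (Suc k + Suc l + 2 * m + 1))"
    by (rule Suc.IH) (use Suc.prems R in simp)
  also have "2 * Suc k + 2 * m + 1 = 2 * k + 2 * Suc m + 1" by simp
  also have "2 * Suc l + 2 * m + 1 = 2 * l + 2 * Suc m + 1" by simp
  also have "Suc k + Suc l + 2 * m + 1 = k + l + 2 * Suc m + 1" by simp
  also have "fact (Suc k) = (1 + of_nat k) * (fact k :: rat)" by simp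
  also have "fact (Suc l) = (1 + of_nat l) * (fact l :: rat)" by simp
  also have "poly (dixon_coeff (of_nat k) (of_nat l)) (of_nat (2 * m + 1)) =
      (2 * of_nat m + 2) * (6 * of_nat m + 2 * of_nat k + 2 * of_nat l + 9) / ((1 + of_nat k) * (1 + of_nat l))"
    unfolding poly_dixon_coeff by (simp add: algebra_simps)
  finally have *: "poly (pderiv (dixon_sum (of_nat k) (of_nat l) Q)) (of_nat (2 * Suc m + 1)) =
      - ((2 * of_nat m + 2) * (6 * of_nat m + 2 * of_nat k + 2 * of_nat l + 9) / ((1 + of_nat k) * (1 + of_nat l))) *
      (- ((- 1) ^ m) * dfac (2 * m) * dfac (6 * m + 2 * Suc k + 2 * Suc l + 3) *
       ((1 + of_nat k) * fact k) * ((1 + of_nat l) * fact l) /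
      (dfac (2 * k + 2 * Suc m + 1) * dfac (2 * l + 2 * Suc m + 1) * fact (k + l + 2 * Suc m + 1)))" .
  have cancel: "- (a * b / (p * q)) * (- e * d * c * (p * x) * (q * y) / z) = e * (a * d) * (b * c) * x * y / z"
    if "p \<noteq> 0" "q \<noteq> 0" for a b c d e p q x y z :: rat
    using that by (simp add: field_simps)
  have "1 + of_nat k \<noteq> (0 :: rat)" "1 + of_nat l \<noteq> (0 :: rat)"
    by (simp_all add: add_nonneg_eq_0_iff)
  then have "poly (pderiv (dixon_sum (of_nat k) (of_nat l) Q)) (of_nat (2 * Suc m + 1)) =
      ((- 1) ^ m) * ((2 * of_nat m + 2) * dfac (2 * m)) *
      ((6 * of_nat m + 2 * of_nat k + 2 * of_nat l + 9) * dfac (6 * m + 2 * Suc k + 2 * Suc l + 3)) * fact k * fact l /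
      (dfac (2 * k + 2 * Suc m + 1) * dfac (2 * l + 2 * Suc m + 1) * fact (k + l + 2 * Suc m + 1))"
    unfolding * by (rule cancel)
  also have "(2 * of_nat m + 2) * dfac (2 * m) = dfac (2 * Suc m)"
    by simp
  also have "(6 * of_nat m + 2 * of_nat k + 2 * of_nat l + 9) * dfac (6 * m + 2 * Suc k + 2 * Suc l + 3) =
      dfac (6 * Suc m + 2 * k + 2 * l + 3)"
  proof -
    have "6 * Suc m + 2 * k + 2 * l + 3 = Suc (Suc (6 * m + 2 * Suc k + 2 * Suc l + 3))" by simp
    then show ?thesis by (simp only: dfac_simps) simp
  qed
  finally show ?case by simp
qed

section \<open>Restriction to the root lattice\<close>

text \<open>Imposes a b c = 1: each coefficient of \<open>f\<close> is the sum of \<open>g\<close>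
  over a coset of \<open>diag\<close>. Large bounds in place of an infinite sum keep every sum
  finite.\<close>

definition diag_sum :: "(wt \<Rightarrow> rat) \<Rightarrow> (wt \<Rightarrow> rat) \<Rightarrow> bool" where
  "diag_sum f g \<longleftrightarrow> (\<forall>\<mu>. \<forall>\<^sub>F B in at_top. f \<mu> = (\<Sum>t\<in>{- B..B}. g (\<mu> - smul t diag)))"

lemma diag_sumI:
  assumes f: "\<And>a b c. f (a, b, c) = g (a - t\<^sub>0 a b c, b - t\<^sub>0 a b c, c - t\<^sub>0 a b c)"
    and g: "\<And>a b c t. t \<noteq> t\<^sub>0 a b c \<Longrightarrow> g (a - t, b - t, c - t) = 0"
  shows "diag_sum f g"
  unfolding diag_sum_def
proof (intro allI eventually_mono[OF eventually_ge_at_top])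
  fix \<mu> :: wt and B :: int
  obtain a b c where \<mu>: "\<mu> = (a, b, c)" by (cases \<mu>)
  assume B: "\<bar>t\<^sub>0 (fst \<mu>) (fst (snd \<mu>)) (snd (snd \<mu>))\<bar> \<le> B"
  have "(\<Sum>t\<in>{- B..B}. g (\<mu> - smul t diag)) = (\<Sum>t\<in>{t\<^sub>0 a b c}. g (\<mu> - smul t diag))"
    by (rule sum.mono_neutral_right) (use B g in \<open>auto simp: \<mu>\<close>)
  then show "f \<mu> = (\<Sum>t\<in>{- B..B}. g (\<mu> - smul t diag))"
    by (simp add: \<mu> f)
qed

lemma diag_sum_add:
  assumes "diag_sum f g" "diag_sum f' g'"
  shows "diag_sum (\<lambda>\<mu>. f \<mu> + f' \<mu>) (\<lambda>\<mu>. g \<mu> + g' \<mu>)"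
  unfolding diag_sum_def
proof
  fix \<mu> :: wt
  show "\<forall>\<^sub>F B in at_top. f \<mu> + f' \<mu> = (\<Sum>t\<in>{- B..B}. g (\<mu> - smul t diag) + g' (\<mu> - smul t diag))"
    using assms[unfolded diag_sum_def, THEN spec, of \<mu>]
    by eventually_elim (simp add: sum.distrib del: smul.simps)
qed

text \<open>A Laurent polynomial has finitely many exponents, so one bound serves all of
  them.\<close>

lemma pair_diag_sum:
  assumes "diag_sum f g"
  shows "\<forall>\<^sub>F B in at_top. pair P f = (\<Sum>t\<in>{- B..B}. pair (E t * P) g)"
proof (induction P rule: poly_mapping_single_induct)
  case (single \<beta> c)
  have "- (smul t diag + \<beta>) = - \<beta> - smul t diag" for t
    by (simp only: minus_add_distrib diff_conv_add_uminus add.commute)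
  then have shift: "pair (E t * Poly_Mapping.single \<beta> c) g = c * g (- \<beta> - smul t diag)" for t
    using pair_single[of "smul t diag + \<beta>" c g] by (simp only: E_def mult_single smul.simps mult_1 mult_1_right)
  have "\<forall>\<^sub>F B in at_top. f (- \<beta>) = (\<Sum>t\<in>{- B..B}. g (- \<beta> - smul t diag))"
    using assms unfolding diag_sum_def by blast
  then show ?case
    unfolding shift by eventually_elim (simp only: pair_single sum_distrib_left)
next
  case (add p q)
  then show ?case
    by eventually_elim (simp add: pair_add distrib_left sum.distrib)
qed

text \<open>Turns a constant term on the root lattice into a sum over q of constant terms in
  independent variables, with q = -t.\<close>

lemma pair_Phi_diag_sum:
  assumes "diag_sum f g" and "\<And>q. q < 0 \<Longrightarrow> pair (Phi u v q) g = 0"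
  shows "\<forall>\<^sub>F N in sequentially. pair (Phi u v 0) f = (\<Sum>q<N. pair (Phi u v (int q)) g)"
proof -
  obtain B\<^sub>0 where B\<^sub>0: "\<And>B. B \<ge> B\<^sub>0 \<Longrightarrow> pair (Phi u v 0) f = (\<Sum>t\<in>{- B..B}. pair (E t * Phi u v 0) g)"
    using pair_diag_sum[OF assms(1)] unfolding eventually_at_top_linorder by blast
  have shift: "E t * Phi u v 0 = Phi u v (- t)" for t
    by (simp add: Phi_def flip: E_add mult.assoc)
  have "pair (Phi u v 0) f = (\<Sum>q<N. pair (Phi u v (int q)) g)" if N: "nat B\<^sub>0 + 1 \<le> N" for N
  proof -
    have "pair (Phi u v 0) f = (\<Sum>t\<in>{- (int N - 1)..int N - 1}. pair (Phi u v (- t)) g)"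
      using B\<^sub>0[of "int N - 1"] N unfolding shift by linarith
    also have "\<dots> = (\<Sum>t\<in>(\<lambda>q. - int q) ` {..<N}. pair (Phi u v (- t)) g)"
    proof (rule sum.mono_neutral_right)
      show "\<forall>t\<in>{- (int N - 1)..int N - 1} - (\<lambda>q. - int q) ` {..<N}. pair (Phi u v (- t)) g = 0"
      proof
        fix t assume t: "t \<in> {- (int N - 1)..int N - 1} - (\<lambda>q. - int q) ` {..<N}"
        have "t > 0"
        proof (rule ccontr)
          assume "\<not> t > 0"
          then have "t = - int (nat (- t))" "nat (- t) < N" using t by auto
          with t show False by blast
        qed
        then show "pair (Phi u v (- t)) g = 0" by (intro assms(2)) simp
      qed
    qed auto
    also have "\<dots> = (\<Sum>q<N. pair (Phi u v (int q)) g)"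
      by (subst sum.reindex) (auto simp: inj_on_def)
    finally show ?thesis .
  qed
  then show ?thesis by (rule eventually_mono[OF eventually_ge_at_top])
qed

section \<open>Cyclic symmetry\<close>

definition cyc :: "wt \<Rightarrow> wt" where "cyc \<mu> = (snd (snd \<mu>), fst \<mu>, fst (snd \<mu>))"

lemma additive_cyc: "Modules.additive cyc"
  by (auto simp: Modules.additive_def cyc_def)

lemma ray_log_cyc: "ray_log (cyc \<alpha>) (cyc \<mu>) = ray_log \<alpha> \<mu>"
proof -
  have "cyc \<mu> = smul n (cyc \<alpha>) \<longleftrightarrow> \<mu> = smul n \<alpha>" for n
    by (cases \<alpha>; cases \<mu>) (auto simp: cyc_def)
  then show ?thesis by (simp only: ray_log_def)
qed

text \<open>A 3-cycle is an even permutation and fixes \<open>Vdm\<close>, whatever the parity of u.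
  Hence the three logarithms of an orbit contribute equally.\<close>

lemma push_cyc_Phi: "push cyc (Phi u v q) = Phi u v q"
proof -
  have g: "push cyc X = Y" "push cyc Y = Z" "push cyc Z = X" "push cyc (E n) = E n" for n
    by (simp_all add: X_def Y_def Z_def E_def cyc_def)
  have "push cyc Vdm = Vdm"
    unfolding Vdm_def push_mult[OF additive_cyc] push_diff g by (simp only: mult_ac)
  moreover have "push cyc Lin = Lin"
    unfolding Lin_def push_mult[OF additive_cyc] push_one[OF additive_cyc] push_diff g by (simp only: mult_ac)
  ultimately show ?thesis
    unfolding Phi_def push_mult[OF additive_cyc] push_power[OF additive_cyc] g by simp
qed

lemma pair_Phi_cyc: "pair (Phi u v q) (ray_log (cyc \<alpha>)) = pair (Phi u v q) (ray_log \<alpha>)"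
  using pair_push[OF additive_cyc, of "Phi u v q" "ray_log (cyc \<alpha>)"]
  by (simp add: push_cyc_Phi ray_log_cyc)

lemma pair_Phi_log_unit: "pair (Phi u v q) log_unit = 3 * pair (Phi u v q) (ray_log (1, 0, 0))"
  using pair_Phi_cyc[of u v q "(1, 0, 0)"] pair_Phi_cyc[of u v q "(0, 1, 0)"]
  unfolding log_unit_def pair_add_right by (simp add: cyc_def)

lemma pair_Phi_log_ratio: "pair (Phi u v q) log_ratio = 3 * pair (Phi u v q) (ray_log w1)"
  using pair_Phi_cyc[of u v q w1] pair_Phi_cyc[of u v q w2]
  unfolding log_ratio_def pair_add_right by (simp add: cyc_def)

subsection \<open>Base values\<close>

text \<open>Substitutes Y/X, Z/Y, X/Z for X, Y, Z; the kernel is spanned by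
  \<open>diag\<close>.\<close>

definition ratio :: "wt \<Rightarrow> wt" where
  "ratio \<mu> = (snd (snd \<mu>) - fst \<mu>, fst \<mu> - fst (snd \<mu>), fst (snd \<mu>) - snd (snd \<mu>))"

lemma additive_ratio: "Modules.additive ratio"
  by (auto simp: Modules.additive_def ratio_def)

text \<open>The substitution turns \<open>Lin\<close> into \<open>E (- 1) * Vdm\<close>, so the base
  value becomes a diagonal sum with Vandermonde exponent 0, to which the recursion applies
  again.\<close>

lemma Phi_eq_push_ratio: "Phi u 0 0 = push ratio (Phi 0 u 0)"
proof -
  have "push ratio Lin = E (- 1) * Vdm"
    unfolding Lin_def Vdm_factor push_mult[OF additive_ratio] push_one[OF additive_ratio] push_diff
    by (simp add: X_def Y_def Z_def ratio_def)
  then show ?thesis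
    by (simp add: Phi_def push_power[OF additive_ratio] power_mult_distrib E_power)
qed

lemma ray_logI:
  assumes "\<alpha> \<noteq> 0" "P \<Longrightarrow> \<mu> = smul n \<alpha>" "\<And>k. \<mu> = smul k \<alpha> \<Longrightarrow> P"
  shows "ray_log \<alpha> \<mu> = (if P \<and> n \<ge> 1 then - 1 / of_int n else 0)"
proof (cases P)
  case True
  then show ?thesis using assms(2) ray_log_smul[OF assms(1), of n] by simp
next
  case False
  then have "ray_log \<alpha> \<mu> = 0" by (intro ray_log_outside) (use assms(3) in blast)
  then show ?thesis using False by simp
qed

lemma ray_log_basis:
  "ray_log (1, 0, 0) (a, b, c) = (if (b = 0 \<and> c = 0) \<and> a \<ge> 1 then - 1 / of_int a else 0)"
  "ray_log (0, 1, 0) (a, b, c) = (if (a = 0 \<and> c = 0) \<and> b \<ge> 1 then - 1 / of_int b else 0)"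
  "ray_log (0, 0, 1) (a, b, c) = (if (a = 0 \<and> b = 0) \<and> c \<ge> 1 then - 1 / of_int c else 0)"
  "ray_log w1 (a, b, c) = (if (a = - b \<and> c = 0) \<and> b \<ge> 1 then - 1 / of_int b else 0)"
  "ray_log w2 (a, b, c) = (if (b = - c \<and> a = 0) \<and> c \<ge> 1 then - 1 / of_int c else 0)"
  "ray_log w3 (a, b, c) = (if (c = - a \<and> b = 0) \<and> a \<ge> 1 then - 1 / of_int a else 0)"
  by (rule ray_logI, simp add: zero_prod_def, simp, simp)+

lemma diag_sum_delta:
  "diag_sum (\<lambda>\<mu>. if ratio \<mu> = 0 then 1 else 0) (\<lambda>\<mu>. if \<mu> = 0 then 1 else 0)"
proof (rule diag_sumI[where t\<^sub>0 = "\<lambda>a b c. a"])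
  fix a b c :: int
  have "ratio (a, b, c) = 0 \<longleftrightarrow> (a - a, b - a, c - a) = (0 :: wt)"
    unfolding ratio_def zero_prod_def fst_conv snd_conv prod.inject by arith
  then show "(if ratio (a, b, c) = 0 then 1 else 0) = (if (a - a, b - a, c - a) = (0 :: wt) then 1 else 0 :: rat)"
    by (simp only:)
qed (simp add: zero_prod_def)

lemma diag_sum_log_ratio: "diag_sum (\<lambda>\<mu>. log_ratio (ratio \<mu>)) log_unit"
proof -
  \<comment> \<open>Each \<open>t\<^sub>0\<close> is the shift that makes a coordinate zero which
    vanishes on the ray in question.\<close>
  have "diag_sum (\<lambda>\<mu>. ray_log w1 (ratio \<mu>)) (ray_log (1, 0, 0))"
    unfolding ratio_def
    by (rule diag_sumI[where t\<^sub>0 = "\<lambda>a b c. b"]; unfold ray_log_basis fst_conv snd_conv;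
        (rule if_cong, arith, rule refl, rule refl | simp))
  moreover have "diag_sum (\<lambda>\<mu>. ray_log w2 (ratio \<mu>)) (ray_log (0, 1, 0))"
    unfolding ratio_def
    by (rule diag_sumI[where t\<^sub>0 = "\<lambda>a b c. c"]; unfold ray_log_basis fst_conv snd_conv;
        (rule if_cong, arith, rule refl, rule refl | simp))
  moreover have "diag_sum (\<lambda>\<mu>. ray_log w3 (ratio \<mu>)) (ray_log (0, 0, 1))"
    unfolding ratio_def
    by (rule diag_sumI[where t\<^sub>0 = "\<lambda>a b c. a"]; unfold ray_log_basis fst_conv snd_conv;
        (rule if_cong, arith, rule refl, rule refl | simp))
  ultimately show ?thesis
    unfolding log_ratio_def[abs_def] log_unit_def[abs_def] by (intro diag_sum_add)
qed

lemma Phi_zero [simp]: "Phi 0 0 0 = 1"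
  by (simp add: Phi_def)

text \<open>With s = t = 0 this is Dixon's alternating sum of cubes of binomial
  coefficients.\<close>

lemma ct_Phi_base: "\<forall>\<^sub>F N in sequentially. ct (Phi u 0 0) = poly (dixon_sum 0 0 N) (of_nat u)"
proof -
  have "ct (Phi u 0 0) = pair (Phi 0 u 0) (\<lambda>\<mu>. if ratio \<mu> = 0 then 1 else 0)"
    unfolding Phi_eq_push_ratio[of u] by (simp only: pair_push[OF additive_ratio] flip: pair_delta)
  moreover have "(\<Sum>q<N. pair (Phi 0 u (int q)) (\<lambda>\<mu>. if \<mu> = 0 then 1 else 0)) =
      poly (dixon_sum 0 0 N) (of_nat u)" for N
    unfolding pair_delta ct_Phi_eq by (simp add: dixon_sum_def poly_sum)
  ultimately show ?thesis
    using pair_Phi_diag_sum[OF diag_sum_delta pair_Phi_neg[OF divergence_free_delta], of 0 u] by simp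
qed

lemma pderiv_dixon_sum: "pderiv (dixon_sum s t N) = (\<Sum>q<N. pderiv (dixon_term s t q))"
  unfolding dixon_sum_def by (induction N) (simp_all add: pderiv_add)

text \<open>For Vandermonde exponent 0 the initial value is the pairing of 1 with
  \<open>log_unit\<close>, which is 0; only the derivative part of \<open>pair_log_unit_eq\<close>
  remains.\<close>

lemma pair_log_ratio_base:
  "\<forall>\<^sub>F N in sequentially. pair (Phi u 0 0) log_ratio = poly (pderiv (dixon_sum 0 0 N)) (of_nat u)"
proof -
  have "log_unit (- 0) = 0"
    by (simp add: log_unit_def zero_prod_def ray_log_basis)
  then have "pair 1 log_unit = 0"
    using pair_single[of 0 1 log_unit] by simp
  then have "(\<Sum>q<N. pair (Phi 0 u (int q)) log_unit) = poly (pderiv (dixon_sum 0 0 N)) (of_nat u)" for N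
    unfolding pair_log_unit_eq pderiv_dixon_sum by (simp add: poly_sum)
  moreover have "pair (Phi u 0 0) log_ratio = pair (Phi 0 u 0) (\<lambda>\<mu>. log_ratio (ratio \<mu>))"
    unfolding Phi_eq_push_ratio[of u] by (rule pair_push[OF additive_ratio])
  ultimately show ?thesis
    using pair_Phi_diag_sum[OF diag_sum_log_ratio pair_log_unit_neg, of 0 u] by simp
qed

text \<open>The exponents in \<open>Phi u 0 0\<close> have coordinate sum 0, whereas
  \<open>log_unit\<close> is supported on positive coordinate sums.\<close>

lemma pair_log_unit_base: "pair (Phi u 0 0) log_unit = 0"
proof -
  have "log_unit (ratio (a, b, c)) = 0" for a b c
    unfolding log_unit_def ratio_def ray_log_basis fst_conv snd_conv
    by (subst if_not_P, arith)+ simp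
  then have "log_unit (ratio \<mu>) = 0" for \<mu>
    by (cases \<mu>) blast
  then show ?thesis
    unfolding Phi_eq_push_ratio[of u] pair_push[OF additive_ratio] by (simp add: pair_def)
qed

subsection \<open>Closed forms\<close>

lemma prod_odd_dfac: "(\<Prod>i<m. 2 * of_nat i + 1) * dfac (2 * m) = fact (2 * m)"
  by (induction m) (simp_all add: algebra_simps)

lemma dfac_even: "dfac (2 * n) = 2 ^ n * fact n"
  by (induction n) (simp_all add: algebra_simps)

lemma dfac_mult_Suc: "dfac (Suc n) * dfac n = fact (Suc n)"
proof (induction n)
  case (Suc n)
  have "dfac (Suc (Suc n)) * dfac (Suc n) = (of_nat n + 2) * (dfac (Suc n) * dfac n)"
    by (simp add: mult_ac)
  also have "\<dots> = fact (Suc (Suc n))"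
    unfolding Suc by (simp add: algebra_simps)
  finally show ?case .
qed simp

lemma prod_dfac: "dfac n * (\<Prod>i<m. of_nat (n + 2 * m - 2 * i)) = dfac (n + 2 * m)"
proof (induction m)
  case (Suc m)
  have "(\<Prod>i<m. of_nat (n + 2 * Suc m - 2 * Suc i)) = (\<Prod>i<m. of_nat (n + 2 * m - 2 * i) :: rat)"
    by (rule prod.cong) simp_all
  then have "dfac n * (\<Prod>i<Suc m. of_nat (n + 2 * Suc m - 2 * i)) =
      of_nat (n + 2 * Suc m) * (dfac n * (\<Prod>i<m. of_nat (n + 2 * m - 2 * i)))"
    by (subst prod.lessThan_Suc_shift) (simp add: mult_ac)
  also have "\<dots> = dfac (n + 2 * Suc m)"
    unfolding Suc by (simp add: algebra_simps)
  finally show ?case .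
qed simp

lemma prod_half_dfac: "(\<Prod>i<m. of_nat (2 * k + 3 + 2 * i) / 2) * 2 ^ m * dfac (2 * k + 1) = dfac (2 * k + 1 + 2 * m)"
  by (induction m) (simp_all add: algebra_simps)

lemma prod_fact: "(\<Prod>i<m. of_nat (n + 1 + i)) * fact n = (fact (n + m) :: rat)"
proof (induction m)
  case (Suc m)
  have "(\<Prod>i<Suc m. of_nat (n + 1 + i)) * fact n =
      of_nat (n + 1 + m) * ((\<Prod>i<m. of_nat (n + 1 + i)) * fact n :: rat)"
    by (simp only: prod.lessThan_Suc mult_ac)
  also have "\<dots> = fact (n + Suc m)"
    unfolding Suc by simp
  finally show ?case .
qed simp

text \<open>The base value, a derivative at odd u = 2k + 1, times Dixon's sum at v = 2m with s =
  u/2, t = u. The 1/3 comes from the orbit of logarithms and the sign from the root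
  products.\<close>

lemma value_long:
  assumes "N > 2 * k + 1" and "M > 2 * m"
  shows "- ((- 1) ^ (k + m)) / 3 * (poly (pderiv (dixon_sum 0 0 N)) (of_nat (2 * k + 1)) *
    poly (dixon_sum (of_nat (2 * k + 1) / 2) (of_nat (2 * k + 1)) M) (of_nat (2 * m))) = G (2 * k + 1) (2 * m)"
proof -
  have 1: "poly (pderiv (dixon_sum 0 0 N)) (of_nat (2 * k + 1)) =
      - ((- 1) ^ k) * dfac (2 * k) * dfac (6 * k + 3) / (dfac (2 * k + 1) * dfac (2 * k + 1) * fact (2 * k + 1))"
    using pderiv_dixon_sum_odd[of k 0 N 0] assms(1) by simp
  define O' T' S' R' where "O' = (\<Prod>i<m. 2 * of_nat i + 1 :: rat)"
    and "T' = (\<Prod>i<m. of_nat (6 * k + 4 * m + 3 + 2 * m - 2 * i) :: rat)"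
    and "S' = (\<Prod>i<m. of_nat (2 * k + 3 + 2 * i) / 2 :: rat)"
    and "R' = (\<Prod>i<m. of_nat (2 * k + 1 + 1 + i) :: rat)"
  have "(\<Prod>i<m. 6 * of_nat m - 2 * of_nat i + 2 * (of_nat (2 * k + 1) / 2) + 2 * of_nat (2 * k + 1)) = T'"
    unfolding T'_def by (rule prod.cong) (simp_all add: of_nat_diff)
  moreover have "(\<Prod>i<m. 1 + of_nat (2 * k + 1) / 2 + of_nat i) = S'"
    unfolding S'_def by (rule prod.cong) (simp_all add: field_simps)
  moreover have "(\<Prod>i<m. 1 + of_nat (2 * k + 1) + of_nat i) = R'"
    unfolding R'_def by (rule prod.cong) simp_all
  ultimately have 2: "poly (dixon_sum (of_nat (2 * k + 1) / 2) (of_nat (2 * k + 1)) M) (of_nat (2 * m)) =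
      (- 1) ^ m * O' * T' / (S' * R')"
    using dixon_sum_even[of "of_nat (2 * k + 1) / 2" "of_nat (2 * k + 1)" m M] assms(2)
    by (simp only: O'_def[symmetric])
  define a b c d where "a = dfac (2 * k)" and "b = dfac (2 * k + 1)" and "c = dfac (2 * m)"
    and "d = dfac (6 * k + 4 * m + 3)"
  define f g x :: rat where "f = fact (2 * k + 1 + m)" and "g = dfac (2 * k + 1 + 2 * m)" and "x = dfac (6 * k + 3)"
  have f1: "fact (2 * k + 1) = b * a" using dfac_mult_Suc[of "2 * k"] by (simp add: a_def b_def)
  have O': "O' * c = fact (2 * m)" unfolding O'_def c_def by (rule prod_odd_dfac)
  have T': "d * T' = dfac (6 * k + 6 * m + 3)"
    using prod_dfac[of "6 * k + 4 * m + 3" m] unfolding d_def T'_def by (simp add: algebra_simps)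
  have S': "S' * 2 ^ m * b = g" unfolding S'_def b_def g_def by (rule prod_half_dfac)
  have R': "R' * (b * a) = f" unfolding f1[symmetric] f_def R'_def by (rule prod_fact)
  have nz: "a \<noteq> 0" "b \<noteq> 0" "c \<noteq> 0" "d \<noteq> 0" "f \<noteq> 0" "g \<noteq> 0"
    by (simp_all add: a_def b_def c_def d_def f_def g_def)
  then have nz': "S' \<noteq> 0" "R' \<noteq> 0" using S' R' by auto
  have "G (2 * k + 1) (2 * m) = 1 / 3 * ((dfac (6 * k + 6 * m + 3) * x * dfac (2 * (2 * k + 1)) * dfac (2 * (2 * m))) /
      (d * dfac (2 * (2 * k + 1 + m)) * g * b * b * c))"
    unfolding G_def x_def b_def c_def d_def g_def by (simp add: algebra_simps)
  also have "\<dots> = 1 / 3 * (((d * T') * x * (2 ^ (2 * k + 1) * (b * a)) * (2 ^ (2 * m) * (O' * c))) /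
      (d * (2 ^ (2 * k + 1 + m) * (R' * (b * a))) * (S' * 2 ^ m * b) * b * b * c))"
    unfolding dfac_even f1 f_def[symmetric] T' O' S' R' ..
  also have "\<dots> = 1 / 3 * (a * x * O' * T' / (b * b * (b * a) * (S' * R')))"
  proof -
    have num: "d * T' * x * (2 ^ (2 * k + 1) * (b * a)) * (2 ^ (2 * m) * (O' * c)) =
        (2 ^ (2 * k + 1) * 2 ^ (2 * m) * d * b * c) * (a * x * O' * T')"
      and den: "d * (2 ^ (2 * k + 1 + m) * (R' * (b * a))) * (S' * 2 ^ m * b) * b * b * c =
        (2 ^ (2 * k + 1 + m) * 2 ^ m * d * b * c) * (b * b * (b * a) * (S' * R'))"
      by (simp_all only: mult_ac)
    \<comment> \<open>Numerator and denominator carry the same power of 2.\<close>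
    have "2 * k + 1 + 2 * m = 2 * k + 1 + m + m" by simp
    then have "2 ^ (2 * k + 1) * 2 ^ (2 * m) = (2 ^ (2 * k + 1 + m) * 2 ^ m :: rat)"
      by (simp only: flip: power_add)
    then show ?thesis
      unfolding num den using nz by (simp only: mult_divide_mult_cancel_left mult_eq_0_iff power_eq_0_iff simp_thms) simp
  qed
  also have "\<dots> = ((- 1) ^ (k + m) * ((- 1) ^ k * (- 1) ^ m)) * (1 / 3 * (a * x * O' * T' / (b * b * (b * a) * (S' * R'))))"
    unfolding power_add[symmetric] minus_one_mult_self by simp
  also have "\<dots> = - ((- 1) ^ (k + m)) / 3 * (- ((- 1) ^ k) * a * x / (b * b * (b * a)) * ((- 1) ^ m * O' * T' / (S' * R')))"
    by (simp add: mult_ac)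
  finally show ?thesis
    unfolding 1 2 f1 a_def[symmetric] b_def[symmetric] x_def[symmetric] by simp
qed

text \<open>The mirror case: Dixon's sum as base value at u = 2k, times a derivative at v = 2m + 1
  whose parameters s = k, t = 2k are natural numbers.\<close>

lemma value_short:
  assumes "N > 2 * k" and "M > 2 * m + 1 + k"
  shows "- ((- 1) ^ (k + m)) / 3 * (poly (dixon_sum 0 0 N) (of_nat (2 * k)) *
    poly (pderiv (dixon_sum (of_nat k) (of_nat (2 * k)) M)) (of_nat (2 * m + 1))) = G (2 * k) (2 * m + 1)"
proof -
  define T where "T = dfac (6 * k + 6 * m + 3)"
  define d e where "d = dfac (2 * k + 2 * m + 1)" and "e = dfac (4 * k + 2 * m + 1)"
  define f g h :: rat where "f = fact k" and "g = fact (2 * k)" and "h = fact (3 * k + 2 * m + 1)"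
  define c p where "c = dfac (2 * m)" and "p = dfac (2 * m + 1)"
  have 1: "poly (pderiv (dixon_sum (of_nat k) (of_nat (2 * k)) M)) (of_nat (2 * m + 1)) =
      - ((- 1) ^ m) * c * T * f * g / (d * e * h)"
    using pderiv_dixon_sum_odd[of m k M "2 * k"] assms(2)
    unfolding T_def d_def e_def f_def g_def h_def c_def by (simp add: algebra_simps)
  define O' T' where "O' = (\<Prod>i<k. 2 * of_nat i + 1 :: rat)"
    and "T' = (\<Prod>i<k. of_nat (4 * k + 2 * k - 2 * i) :: rat)"
  have "(\<Prod>i<k. 6 * of_nat k - 2 * of_nat i + 2 * 0 + 2 * 0) = T'"
    unfolding T'_def by (rule prod.cong) (simp_all add: of_nat_diff)
  moreover have "(\<Prod>i<k. 1 + 0 + of_nat i) = f"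
    using prod_fact[of 0 k] by (simp add: f_def)
  ultimately have 2: "poly (dixon_sum 0 0 N) (of_nat (2 * k)) = (- 1) ^ k * O' * T' / (f * f)"
    using dixon_sum_even[of 0 0 k N] assms(1) by (simp only: O'_def[symmetric])
  have O': "O' * dfac (2 * k) = g" unfolding O'_def g_def by (rule prod_odd_dfac)
  have T': "dfac (4 * k) * T' = dfac (6 * k)"
    using prod_dfac[of "4 * k" k] unfolding T'_def by simp
  have d4: "dfac (4 * k) = 2 ^ (2 * k) * g"
    using dfac_even[of "2 * k"] by (simp add: g_def)
  have q: "fact (2 * m + 1) = p * c" using dfac_mult_Suc[of "2 * m"] by (simp add: c_def p_def)
  have nz: "f \<noteq> 0" "g \<noteq> 0" "h \<noteq> 0" "d \<noteq> 0" "e \<noteq> 0" "c \<noteq> 0" "p \<noteq> 0"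
    by (simp_all add: d_def e_def f_def g_def h_def c_def p_def)
  have "G (2 * k) (2 * m + 1) = 1 / 3 * ((T * dfac (6 * k) * dfac (4 * k) * dfac (2 * (2 * m + 1))) /
      (dfac (2 * (3 * k + 2 * m + 1)) * e * d * dfac (2 * k) * dfac (2 * k) * p))"
    unfolding G_def T_def d_def e_def p_def by (simp add: algebra_simps)
  also have "\<dots> = 1 / 3 * ((T * (dfac (4 * k) * T') * dfac (2 * (2 * k)) * dfac (2 * (2 * m + 1))) /
      (dfac (2 * (3 * k + 2 * m + 1)) * e * d * dfac (2 * k) * dfac (2 * k) * p))"
    unfolding T' by simp
  also have "\<dots> = 1 / 3 * ((T * ((2 ^ (2 * k) * g) * T') * (2 ^ (2 * k) * g) * (2 ^ (2 * m + 1) * (p * c))) /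
      ((2 ^ (3 * k + 2 * m + 1) * h) * e * d * (2 ^ k * f) * (2 ^ k * f) * p))"
    unfolding d4 dfac_even q h_def[symmetric] g_def[symmetric] f_def[symmetric] ..
  also have "\<dots> = 1 / 3 * (O' * T' * c * T * g / (f * d * e * h))"
  proof -
    \<comment> \<open>One of the two factors (2k)! is split as (2k-1)!! (2k)!!, so that
      \<open>O'\<close> appears.\<close>
    have g: "g = O' * (2 ^ k * f)" using O' by (simp add: dfac_even f_def)
    have num: "T * ((2 ^ (2 * k) * g) * T') * (2 ^ (2 * k) * (O' * (2 ^ k * f))) * (2 ^ (2 * m + 1) * (p * c)) =
        (2 ^ (2 * k) * 2 ^ (2 * k) * 2 ^ k * 2 ^ (2 * m + 1) * f * p) * (O' * T' * c * T * g)"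
      and den: "(2 ^ (3 * k + 2 * m + 1) * h) * e * d * (2 ^ k * f) * (2 ^ k * f) * p =
        (2 ^ (3 * k + 2 * m + 1) * 2 ^ k * 2 ^ k * f * p) * (f * d * e * h)"
      by (simp_all only: mult_ac)
    have "2 * k + 2 * k + k + (2 * m + 1) = 3 * k + 2 * m + 1 + k + k" by simp
    then have "2 ^ (2 * k) * 2 ^ (2 * k) * 2 ^ k * 2 ^ (2 * m + 1) = (2 ^ (3 * k + 2 * m + 1) * 2 ^ k * 2 ^ k :: rat)"
      by (simp only: flip: power_add)
    then have "T * ((2 ^ (2 * k) * g) * T') * (2 ^ (2 * k) * (O' * (2 ^ k * f))) * (2 ^ (2 * m + 1) * (p * c)) /
        ((2 ^ (3 * k + 2 * m + 1) * h) * e * d * (2 ^ k * f) * (2 ^ k * f) * p) =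
        O' * T' * c * T * g / (f * d * e * h)"
      unfolding num den using nz by (simp only: mult_divide_mult_cancel_left mult_eq_0_iff power_eq_0_iff simp_thms) simp
    then show ?thesis unfolding g[symmetric] by simp
  qed
  also have "\<dots> = ((- 1) ^ (k + m) * ((- 1) ^ k * (- 1) ^ m)) * (1 / 3 * (O' * T' * c * T * g / (f * d * e * h)))"
    unfolding power_add[symmetric] minus_one_mult_self by simp
  also have "\<dots> = - ((- 1) ^ (k + m)) / 3 * ((- 1) ^ k * O' * T' / (f * f) * (- ((- 1) ^ m) * c * T * f * g / (d * e * h)))"
    using nz by (simp add: mult_ac)
  finally show ?thesis
    unfolding 1 2 by simp
qed

section \<open>The root system \<open>G\<^sub>2\<close>\<close>

text \<open>Evaluates a, b, c at the short roots with sum zero, so the kernel is spanned by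
  \<open>diag\<close>. The third variable is a negative root.\<close>

definition weight :: "wt \<Rightarrow> real^3" where
  "weight \<mu> = real_of_int (fst \<mu>) *\<^sub>R (\<epsilon> 1 - \<epsilon> 2) + real_of_int (fst (snd \<mu>)) *\<^sub>R (\<epsilon> 2 - \<epsilon> 3)
     + real_of_int (snd (snd \<mu>)) *\<^sub>R (\<epsilon> 3 - \<epsilon> 1)"

lemma additive_weight: "Modules.additive weight"
  by (auto simp: Modules.additive_def weight_def algebra_simps)

lemma weight_component:
  "weight (a, b, c) $ 1 = of_int (a - c)" "weight (a, b, c) $ 2 = of_int (b - a)"
  "weight (a, b, c) $ 3 = of_int (c - b)"
  by (simp_all add: weight_def axis_def)

lemma weight_eq_iff: "weight (a, b, c) = weight (a', b', c') \<longleftrightarrow> a - c = a' - c' \<and> b - a = b' - a'"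
  unfolding vec_eq_iff forall_3 weight_component of_int_eq_iff by arith

lemma roots_weight:
  "\<alpha>1 = weight (1, 0, 0)" "\<alpha>2 = weight w1"
  "short_pos_roots = weight ` {(1, 0, 0), (0, 1, 0), (0, 0, - 1)}"
  "long_pos_roots = weight ` {w1, (1, 0, - 1), (0, 1, - 1)}"
proof -
  show "\<alpha>1 = weight (1, 0, 0)" "\<alpha>2 = weight w1"
    by (simp_all add: \<alpha>1_def \<alpha>2_def weight_def vec_eq_iff forall_3 axis_def)
  show "short_pos_roots = weight ` {(1, 0, 0), (0, 1, 0), (0, 0, - 1)}"
    by (simp add: short_pos_roots_eq weight_def insert_commute)
  have "weight w1 = 2 *\<^sub>R \<epsilon> 2 - \<epsilon> 1 - \<epsilon> 3" "weight (1, 0, - 1) = 2 *\<^sub>R \<epsilon> 1 - \<epsilon> 2 - \<epsilon> 3"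
    "weight (0, 1, - 1) = \<epsilon> 1 + \<epsilon> 2 - 2 *\<^sub>R \<epsilon> 3"
    by (simp_all add: weight_def vec_eq_iff forall_3 axis_def)
  then show "long_pos_roots = weight ` {w1, (1, 0, - 1), (0, 1, - 1)}"
    by (simp add: long_pos_roots_eq)
qed

lemma weight_uminus: "weight (- \<mu>) = - weight \<mu>"
  by (rule Modules.additive.minus[OF additive_weight])

lemma all_roots_weight:
  "short_roots = weight ` {(1, 0, 0), (0, 1, 0), (0, 0, - 1), (- 1, 0, 0), (0, - 1, 0), (0, 0, 1)}"
  "long_roots = weight ` {w1, (1, 0, - 1), (0, 1, - 1), (1, - 1, 0), (- 1, 0, 1), (0, - 1, 1)}"
proof -
  have "uminus ` weight ` A = weight ` uminus ` A" for A
    by (simp add: image_image weight_uminus)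
  then show "short_roots = weight ` {(1, 0, 0), (0, 1, 0), (0, 0, - 1), (- 1, 0, 0), (0, - 1, 0), (0, 0, 1)}"
    "long_roots = weight ` {w1, (1, 0, - 1), (0, 1, - 1), (1, - 1, 0), (- 1, 0, 1), (0, - 1, 1)}"
    unfolding short_roots_def long_roots_def roots_weight by (simp_all only: flip: image_Un) (simp, blast)+
qed

lemma fexp_weight: "fexp (weight \<mu>) = push weight (emon \<mu>)"
  by (simp add: fexp_def)

lemma prod_short_pos_roots:
  "(\<Prod>\<alpha>\<in>short_pos_roots. f \<alpha>) = f (weight (1, 0, 0)) * f (weight (0, 1, 0)) * f (weight (0, 0, - 1))"
  for f :: "real^3 \<Rightarrow> 'a::comm_monoid_mult"
  unfolding roots_weight by (simp add: weight_eq_iff mult.assoc)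

lemma prod_long_pos_roots:
  "(\<Prod>\<alpha>\<in>long_pos_roots. f \<alpha>) = f (weight w1) * f (weight (1, 0, - 1)) * f (weight (0, 1, - 1))"
  for f :: "real^3 \<Rightarrow> 'a::comm_monoid_mult"
  unfolding roots_weight by (simp add: weight_eq_iff mult.assoc)

lemma prod_short_roots:
  "(\<Prod>\<alpha>\<in>short_roots. f \<alpha>) = f (weight (1, 0, 0)) * f (weight (0, 1, 0)) * f (weight (0, 0, - 1)) *
     f (weight (- 1, 0, 0)) * f (weight (0, - 1, 0)) * f (weight (0, 0, 1))"
  for f :: "real^3 \<Rightarrow> 'a::comm_monoid_mult"
  unfolding all_roots_weight by (simp add: weight_eq_iff mult.assoc)

lemma prod_long_roots:
  "(\<Prod>\<alpha>\<in>long_roots. f \<alpha>) = f (weight w1) * f (weight (1, 0, - 1)) * f (weight (0, 1, - 1)) *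
     f (weight (1, - 1, 0)) * f (weight (- 1, 0, 1)) * f (weight (0, - 1, 1))"
  for f :: "real^3 \<Rightarrow> 'a::comm_monoid_mult"
  unfolding all_roots_weight by (simp add: weight_eq_iff mult.assoc)

section \<open>The logarithms of the simple roots\<close>

lemma log_one_minus_fexp_scaleR:
  assumes "\<alpha> \<noteq> 0"
  shows "log_one_minus_fexp \<alpha> (real_of_int n *\<^sub>R \<alpha>) = (if n \<ge> 1 then - 1 / of_int n else 0)"
proof (cases "n \<ge> 0")
  case True
  then have "log_one_minus_fexp \<alpha> (real_of_int n *\<^sub>R \<alpha>) = fps_nth fps_log_one_minus (nat n)"
    using fps_at_fexp_scaleR[OF assms, of fps_log_one_minus "nat n"] by (simp add: log_one_minus_fexp_def)
  then show ?thesis using True by (auto simp: fps_log_one_minus_def)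
next
  case False
  then have "{N. real N *\<^sub>R \<alpha> = real_of_int n *\<^sub>R \<alpha>} = {}"
    using assms by auto
  then show ?thesis using False by (simp add: log_one_minus_fexp_def fps_at_fexp_def)
qed

lemma log_one_minus_fexp_outside:
  assumes "\<And>n. \<mu> \<noteq> real_of_int n *\<^sub>R \<alpha>"
  shows "log_one_minus_fexp \<alpha> \<mu> = 0"
proof -
  have "{N. real N *\<^sub>R \<alpha> = \<mu>} = {}"
    using assms[of "int _"] by auto
  then show ?thesis by (simp add: log_one_minus_fexp_def fps_at_fexp_def)
qed

lemma weight_smul: "real_of_int n *\<^sub>R weight \<alpha> = weight (smul n \<alpha>)"
  by (cases \<alpha>) (simp add: weight_def algebra_simps)

lemma log_weightI:
  assumes "weight \<alpha> \<noteq> 0" "P \<Longrightarrow> weight \<mu> = weight (smul n \<alpha>)" "\<And>k. weight \<mu> = weight (smul k \<alpha>) \<Longrightarrow> P"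
  shows "log_one_minus_fexp (weight \<alpha>) (weight \<mu>) = (if P \<and> n \<ge> 1 then - 1 / of_int n else 0)"
proof (cases P)
  case True
  then show ?thesis
    using assms(2) log_one_minus_fexp_scaleR[OF assms(1), of n] by (simp add: weight_smul)
next
  case False
  then have "log_one_minus_fexp (weight \<alpha>) (weight \<mu>) = 0"
    by (intro log_one_minus_fexp_outside) (use assms(3) in \<open>auto simp: weight_smul\<close>)
  then show ?thesis using False by simp
qed

lemma weight_zero: "weight 0 = 0"
  by (rule Modules.additive.zero[OF additive_weight])

text \<open>Modulo \<open>diag\<close>, (a, b, c) is n (1, 0, 0) exactly if b = c and n = a - b, and
  n (-1, 1, 0) exactly if a + b = 2c and n = b - c.\<close>

lemma log_one_minus_fexp_weight:
  "log_one_minus_fexp \<alpha>1 (weight (a, b, c)) = (if b = c \<and> a - b \<ge> 1 then - 1 / of_int (a - b) else 0)"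
  "log_one_minus_fexp \<alpha>2 (weight (a, b, c)) = (if a + b = 2 * c \<and> b - c \<ge> 1 then - 1 / of_int (b - c) else 0)"
proof -
  have nz: "weight (1, 0, 0) \<noteq> 0" "weight w1 \<noteq> 0"
    unfolding weight_zero[symmetric] zero_prod_def weight_eq_iff by simp_all
  show "log_one_minus_fexp \<alpha>1 (weight (a, b, c)) = (if b = c \<and> a - b \<ge> 1 then - 1 / of_int (a - b) else 0)"
    unfolding roots_weight(1) by (rule log_weightI[OF nz(1)]; unfold smul.simps weight_eq_iff; arith)
  show "log_one_minus_fexp \<alpha>2 (weight (a, b, c)) = (if a + b = 2 * c \<and> b - c \<ge> 1 then - 1 / of_int (b - c) else 0)"
    unfolding roots_weight(2) by (rule log_weightI[OF nz(2)]; unfold smul.simps weight_eq_iff; arith)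
qed

lemma diag_sum_short: "diag_sum (\<lambda>\<mu>. log_one_minus_fexp \<alpha>1 (weight \<mu>)) (ray_log (1, 0, 0))"
  by (rule diag_sumI[where t\<^sub>0 = "\<lambda>a b c. b"]; unfold ray_log_basis log_one_minus_fexp_weight;
      (rule if_cong, arith, rule refl, rule refl | simp))

lemma diag_sum_long: "diag_sum (\<lambda>\<mu>. log_one_minus_fexp \<alpha>2 (weight \<mu>)) (ray_log w1)"
  by (rule diag_sumI[where t\<^sub>0 = "\<lambda>a b c. c"]; unfold ray_log_basis log_one_minus_fexp_weight;
      (rule if_cong, arith, rule refl, rule refl | simp))

section \<open>Products over the roots\<close>

lemma CT_lmult: "CT (lmult P F) = pair P F"
  by (simp add: CT_def lmult_def pair_def)

lemma push_weight_E: "push weight (E n) = 1"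
proof -
  have "weight (n, n, n) = 0"
    unfolding weight_zero[symmetric] zero_prod_def weight_eq_iff by simp
  then show ?thesis by (simp add: E_def)
qed

text \<open>Opposite roots combine into squares. The monomials left over multiply to 1 or
  \<open>E (- 1)\<close>, both trivial on the root lattice.\<close>

lemma root_pair: "(1 - emon \<alpha>) * (1 - emon (- \<alpha>)) = - (emon (- \<alpha>) * (1 - emon \<alpha>)\<^sup>2)"
  by (simp add: power2_eq_square algebra_simps mult_single)

lemma push_one_minus: "1 - fexp (weight \<mu>) = push weight (1 - emon \<mu>)"
  by (simp add: push_diff push_one[OF additive_weight] fexp_def)

lemma prod_long_roots_eq: "(\<Prod>\<alpha>\<in>long_roots. 1 - fexp \<alpha>) = - (push weight (E (- 1) * Vdm))\<^sup>2"
proof -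
  have "(1 - emon w1) * (1 - emon (1, 0, - 1)) * (1 - emon (0, 1, - 1)) * (1 - emon (1, - 1, 0)) *
      (1 - emon (- 1, 0, 1)) * (1 - emon (0, - 1, 1)) =
      ((1 - emon w1) * (1 - emon (- w1))) * ((1 - emon w2) * (1 - emon (- w2))) * ((1 - emon w3) * (1 - emon (- w3)))"
    by (simp add: mult_ac)
  also have "\<dots> = - (emon (- w1) * emon (- w2) * emon (- w3) * (E (- 1) * Vdm)\<^sup>2)"
    unfolding root_pair Vdm_factor power_mult_distrib by (simp only: mult_ac mult_minus_left mult_minus_right minus_minus)
  also have "emon (- w1) * emon (- w2) * emon (- w3) = 1"
    by (simp add: mult_single flip: zero_prod_def)
  finally show ?thesis
    unfolding prod_long_roots push_one_minus push_mult[OF additive_weight, symmetric]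
    by (simp add: push_uminus push_power[OF additive_weight])
qed

lemma prod_short_roots_eq: "(\<Prod>\<alpha>\<in>short_roots. 1 - fexp \<alpha>) = - (push weight Lin)\<^sup>2"
proof -
  have "(1 - emon (1, 0, 0)) * (1 - emon (0, 1, 0)) * (1 - emon (0, 0, - 1)) * (1 - emon (- 1, 0, 0)) *
      (1 - emon (0, - 1, 0)) * (1 - emon (0, 0, 1)) =
      ((1 - X) * (1 - emon (- (1, 0, 0)))) * ((1 - Y) * (1 - emon (- (0, 1, 0)))) * ((1 - Z) * (1 - emon (- (0, 0, 1))))"
    by (simp add: X_def Y_def Z_def mult_ac)
  also have "\<dots> = - (emon (- (1, 0, 0)) * emon (- (0, 1, 0)) * emon (- (0, 0, 1)) * Lin\<^sup>2)"
    unfolding X_def Y_def Z_def Lin_def root_pair power_mult_distrib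
    by (simp only: mult_ac mult_minus_left mult_minus_right minus_minus)
  also have "emon (- (1, 0, 0)) * emon (- (0, 1, 0)) * emon (- (0, 0, 1)) = E (- 1)"
    by (simp add: mult_single E_def)
  finally show ?thesis
    unfolding prod_short_roots push_one_minus push_mult[OF additive_weight, symmetric]
    by (simp add: push_uminus push_mult[OF additive_weight] push_power[OF additive_weight] push_weight_E)
qed

text \<open>The prefactor is the inverse exponential of the highest root: it replaces that root by
  its negative \<open>w2\<close>, up to sign, and makes the product cyclically symmetric.\<close>

lemma prod_long_pos_roots_eq:
  "fexp (- 3 *\<^sub>R \<alpha>1 - 2 *\<^sub>R \<alpha>2) * (\<Prod>\<alpha>\<in>long_pos_roots. 1 - fexp \<alpha>) = - push weight (E (- 1) * Vdm)"
proof -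
  have lead: "- 3 *\<^sub>R \<alpha>1 - 2 *\<^sub>R \<alpha>2 = weight w2"
    by (simp add: \<alpha>1_def \<alpha>2_def weight_def vec_eq_iff forall_3 axis_def)
  have cancel: "emon w2 * (1 - emon (0, 1, - 1)) = - (1 - emon w2)"
    by (simp add: right_diff_distrib mult_single flip: zero_prod_def)
  have "emon w2 * ((1 - emon w1) * (1 - emon (1, 0, - 1)) * (1 - emon (0, 1, - 1))) =
      (1 - emon w1) * (1 - emon w3) * (emon w2 * (1 - emon (0, 1, - 1)))"
    by (simp only: mult_ac)
  also have "\<dots> = - (E (- 1) * Vdm)"
    unfolding cancel Vdm_factor by (simp only: mult_minus_right mult_ac)
  finally have prod: "emon w2 * ((1 - emon w1) * (1 - emon (1, 0, - 1)) * (1 - emon (0, 1, - 1))) =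
      - (E (- 1) * Vdm)" .
  show ?thesis
    unfolding lead prod_long_pos_roots push_one_minus
    unfolding fexp_weight push_mult[OF additive_weight, symmetric] prod push_uminus ..
qed

text \<open>Likewise with the highest short root, whose negative is the exponent of Z.\<close>

lemma prod_short_pos_roots_eq:
  "fexp (- 2 *\<^sub>R \<alpha>1 - \<alpha>2) * (\<Prod>\<alpha>\<in>short_pos_roots. 1 - fexp \<alpha>) = - push weight Lin"
proof -
  have lead: "- 2 *\<^sub>R \<alpha>1 - \<alpha>2 = weight (0, 0, 1)"
    by (simp add: \<alpha>1_def \<alpha>2_def weight_def vec_eq_iff forall_3 axis_def)
  have cancel: "emon (0, 0, 1) * (1 - emon (0, 0, - 1)) = - (1 - emon (0, 0, 1))"
    by (simp add: right_diff_distrib mult_single flip: zero_prod_def)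
  have "emon (0, 0, 1) * ((1 - emon (1, 0, 0)) * (1 - emon (0, 1, 0)) * (1 - emon (0, 0, - 1))) =
      (1 - emon (1, 0, 0)) * (1 - emon (0, 1, 0)) * (emon (0, 0, 1) * (1 - emon (0, 0, - 1)))"
    by (simp only: mult_ac)
  also have "\<dots> = - Lin"
    unfolding cancel Lin_def X_def Y_def Z_def by (simp only: mult_minus_right)
  finally have prod: "emon (0, 0, 1) * ((1 - emon (1, 0, 0)) * (1 - emon (0, 1, 0)) * (1 - emon (0, 0, - 1))) = - Lin" .
  show ?thesis
    unfolding lead prod_short_pos_roots push_one_minus
    unfolding fexp_weight push_mult[OF additive_weight, symmetric] prod push_uminus ..
qed

lemma push_weight_Phi: "push weight (Phi u v 0) = push weight (E (- 1) * Vdm) ^ u * push weight Lin ^ v"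
  unfolding Phi_def push_mult[OF additive_weight] push_power[OF additive_weight] push_weight_E
  by (simp add: mult.commute)

text \<open>Collects the signs and produces the exponents K and M; the second identity uses it with
  the two factors exchanged.\<close>

lemma minus_power_product:
  fixes v l :: "'a::comm_ring_1"
  shows "- v * (- v\<^sup>2) ^ k * (- l\<^sup>2) ^ m = - ((- 1) ^ (k + m) * (v ^ (2 * k + 1) * l ^ (2 * m)))"
proof -
  have "(- v\<^sup>2) ^ k = (- 1) ^ k * v ^ (2 * k)" "(- l\<^sup>2) ^ m = (- 1) ^ m * l ^ (2 * m)"
    by (simp_all add: power_minus[of "_\<^sup>2"] power_mult)
  then show ?thesis by (simp add: power_add mult_ac)
qed

lemma CT_signed_push:
  "CT (lmult (- ((- 1) ^ n * push weight P)) F) = - ((- 1) ^ n) * pair P (\<lambda>\<mu>. F (weight \<mu>))"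
  unfolding CT_lmult pair_uminus pair_minus_one_power pair_push[OF additive_weight] by simp

theorem theorem6p2:
  fixes k m :: nat
  shows "CT (lmult
           (fexp (- 3 *\<^sub>R \<alpha>1 - 2 *\<^sub>R \<alpha>2)
             * (\<Prod>\<alpha>\<in>long_pos_roots. 1 - fexp \<alpha>)
             * (\<Prod>\<alpha>\<in>long_roots. (1 - fexp \<alpha>) ^ k)
             * (\<Prod>\<alpha>\<in>short_roots. (1 - fexp \<alpha>) ^ m))
           (log_one_minus_fexp \<alpha>2))
         = G (2 * k + 1) (2 * m)
       \<and> CT (lmult
           (fexp (- 2 *\<^sub>R \<alpha>1 - \<alpha>2)
             * (\<Prod>\<alpha>\<in>short_pos_roots. 1 - fexp \<alpha>)
             * (\<Prod>\<alpha>\<in>long_roots. (1 - fexp \<alpha>) ^ k)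
             * (\<Prod>\<alpha>\<in>short_roots. (1 - fexp \<alpha>) ^ m))
           (log_one_minus_fexp \<alpha>1))
         = G (2 * k) (2 * m + 1)"
proof
  let ?u = "2 * k + 1"
  have "fexp (- 3 *\<^sub>R \<alpha>1 - 2 *\<^sub>R \<alpha>2) * (\<Prod>\<alpha>\<in>long_pos_roots. 1 - fexp \<alpha>)
      * (\<Prod>\<alpha>\<in>long_roots. (1 - fexp \<alpha>) ^ k) * (\<Prod>\<alpha>\<in>short_roots. (1 - fexp \<alpha>) ^ m) =
      - ((- 1) ^ (k + m) * push weight (Phi ?u (2 * m) 0))"
    unfolding prod_long_pos_roots_eq prod_power_distrib[symmetric] prod_long_roots_eq prod_short_roots_eq
      minus_power_product push_weight_Phi ..
  moreover have "pair (Phi ?u (2 * m) 0) (\<lambda>\<mu>. log_one_minus_fexp \<alpha>2 (weight \<mu>)) * - ((- 1) ^ (k + m)) =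
      G ?u (2 * m)"
  proof -
    \<comment> \<open>Oddness of the Vandermonde exponent is what makes \<open>log_ratio\<close>
      divergence-free.\<close>
    have odd: "odd ?u" by simp
    have "pair (Phi ?u (2 * m) q) (ray_log w1) = 0" if "q < 0" for q
      using pair_Phi_neg[OF divergence_free_log_ratio[OF odd] that] pair_Phi_log_ratio[of ?u "2 * m" q] by simp
    then have "\<forall>\<^sub>F N in sequentially. pair (Phi ?u (2 * m) 0) (\<lambda>\<mu>. log_one_minus_fexp \<alpha>2 (weight \<mu>)) =
        (\<Sum>q<N. pair (Phi ?u (2 * m) (int q)) (ray_log w1))"
      by (rule pair_Phi_diag_sum[OF diag_sum_long])
    then have "\<forall>\<^sub>F N in sequentially. pair (Phi ?u (2 * m) 0) (\<lambda>\<mu>. log_one_minus_fexp \<alpha>2 (weight \<mu>)) =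
          (\<Sum>q<N. pair (Phi ?u (2 * m) (int q)) (ray_log w1))
        \<and> pair (Phi ?u 0 0) log_ratio = poly (pderiv (dixon_sum 0 0 N)) (of_nat ?u) \<and> N > ?u \<and> N > 2 * m"
      by (intro eventually_conj pair_log_ratio_base eventually_gt_at_top)
    \<comment> \<open>A single N beyond all truncation bounds serves both Dixon sums.\<close>
    then obtain N where N: "pair (Phi ?u (2 * m) 0) (\<lambda>\<mu>. log_one_minus_fexp \<alpha>2 (weight \<mu>)) =
          (\<Sum>q<N. pair (Phi ?u (2 * m) (int q)) (ray_log w1))"
        "pair (Phi ?u 0 0) log_ratio = poly (pderiv (dixon_sum 0 0 N)) (of_nat ?u)" "N > ?u" "N > 2 * m"
      by (auto dest!: eventually_happens)
    \<comment> \<open>The 3 replaces the logarithm of one ratio by its orbit sum.\<close>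
    have "3 * (\<Sum>q<N. pair (Phi ?u (2 * m) (int q)) (ray_log w1)) =
        (\<Sum>q<N. pair (Phi ?u (2 * m) (int q)) log_ratio)"
      unfolding pair_Phi_log_ratio sum_distrib_left ..
    also have "\<dots> = poly (dixon_sum (of_nat ?u / 2) (of_nat ?u) N) (of_nat (2 * m)) * pair (Phi ?u 0 0) log_ratio"
      unfolding pair_Phi_eq[OF divergence_free_log_ratio[OF odd]] dixon_sum_def poly_sum sum_distrib_right ..
    finally have "3 * pair (Phi ?u (2 * m) 0) (\<lambda>\<mu>. log_one_minus_fexp \<alpha>2 (weight \<mu>)) =
        poly (pderiv (dixon_sum 0 0 N)) (of_nat ?u) * poly (dixon_sum (of_nat ?u / 2) (of_nat ?u) N) (of_nat (2 * m))"
      unfolding N(1)[symmetric] N(2) by (simp only: mult.commute)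
    then show ?thesis
      unfolding value_long[OF N(3,4), symmetric] by (simp add: field_simps)
  qed
  ultimately show "CT (lmult
           (fexp (- 3 *\<^sub>R \<alpha>1 - 2 *\<^sub>R \<alpha>2)
             * (\<Prod>\<alpha>\<in>long_pos_roots. 1 - fexp \<alpha>)
             * (\<Prod>\<alpha>\<in>long_roots. (1 - fexp \<alpha>) ^ k)
             * (\<Prod>\<alpha>\<in>short_roots. (1 - fexp \<alpha>) ^ m))
           (log_one_minus_fexp \<alpha>2))
         = G (2 * k + 1) (2 * m)"
    by (simp only: CT_signed_push mult.commute)
next
  let ?v = "2 * m + 1"
  have "fexp (- 2 *\<^sub>R \<alpha>1 - \<alpha>2) * (\<Prod>\<alpha>\<in>short_pos_roots. 1 - fexp \<alpha>)
      * (\<Prod>\<alpha>\<in>long_roots. (1 - fexp \<alpha>) ^ k) * (\<Prod>\<alpha>\<in>short_roots. (1 - fexp \<alpha>) ^ m) =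
      - push weight Lin * (- (push weight Lin)\<^sup>2) ^ m * (- (push weight (E (- 1) * Vdm))\<^sup>2) ^ k"
    unfolding prod_short_pos_roots_eq prod_power_distrib[symmetric] prod_long_roots_eq prod_short_roots_eq
    by (simp only: mult_ac)
  also have "\<dots> = - ((- 1) ^ (k + m) * push weight (Phi (2 * k) ?v 0))"
    unfolding minus_power_product push_weight_Phi by (simp only: mult.commute add.commute)
  finally have P: "fexp (- 2 *\<^sub>R \<alpha>1 - \<alpha>2) * (\<Prod>\<alpha>\<in>short_pos_roots. 1 - fexp \<alpha>)
      * (\<Prod>\<alpha>\<in>long_roots. (1 - fexp \<alpha>) ^ k) * (\<Prod>\<alpha>\<in>short_roots. (1 - fexp \<alpha>) ^ m) =
      - ((- 1) ^ (k + m) * push weight (Phi (2 * k) ?v 0))" .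
  have "pair (Phi (2 * k) ?v 0) (\<lambda>\<mu>. log_one_minus_fexp \<alpha>1 (weight \<mu>)) * - ((- 1) ^ (k + m)) =
      G (2 * k) ?v"
  proof -
    have "pair (Phi (2 * k) ?v q) (ray_log (1, 0, 0)) = 0" if "q < 0" for q
      using pair_log_unit_neg[OF that] pair_Phi_log_unit[of "2 * k" ?v q] by simp
    then have "\<forall>\<^sub>F N in sequentially. pair (Phi (2 * k) ?v 0) (\<lambda>\<mu>. log_one_minus_fexp \<alpha>1 (weight \<mu>)) =
        (\<Sum>q<N. pair (Phi (2 * k) ?v (int q)) (ray_log (1, 0, 0)))"
      by (rule pair_Phi_diag_sum[OF diag_sum_short])
    then have "\<forall>\<^sub>F N in sequentially. pair (Phi (2 * k) ?v 0) (\<lambda>\<mu>. log_one_minus_fexp \<alpha>1 (weight \<mu>)) =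
          (\<Sum>q<N. pair (Phi (2 * k) ?v (int q)) (ray_log (1, 0, 0)))
        \<and> ct (Phi (2 * k) 0 0) = poly (dixon_sum 0 0 N) (of_nat (2 * k)) \<and> N > 2 * k \<and> N > 2 * m + 1 + k"
      by (intro eventually_conj ct_Phi_base eventually_gt_at_top)
    then obtain N where N: "pair (Phi (2 * k) ?v 0) (\<lambda>\<mu>. log_one_minus_fexp \<alpha>1 (weight \<mu>)) =
          (\<Sum>q<N. pair (Phi (2 * k) ?v (int q)) (ray_log (1, 0, 0)))"
        "ct (Phi (2 * k) 0 0) = poly (dixon_sum 0 0 N) (of_nat (2 * k))" "N > 2 * k" "N > 2 * m + 1 + k"
      by (auto dest!: eventually_happens)
    have half: "of_nat (2 * k) / 2 = (of_nat k :: rat)" by simp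
    have "3 * (\<Sum>q<N. pair (Phi (2 * k) ?v (int q)) (ray_log (1, 0, 0))) =
        (\<Sum>q<N. pair (Phi (2 * k) ?v (int q)) log_unit)"
      unfolding pair_Phi_log_unit sum_distrib_left ..
    \<comment> \<open>The initial value with \<open>log_unit\<close> is 0, so only the derivative
      term of \<open>pair_log_unit_eq\<close> survives.\<close>
    also have "\<dots> = poly (pderiv (dixon_sum (of_nat k) (of_nat (2 * k)) N)) (of_nat ?v) * ct (Phi (2 * k) 0 0)"
      unfolding pair_log_unit_eq pair_log_unit_base pderiv_dixon_sum poly_sum half
      by (simp only: mult_zero_right add_0_right sum_distrib_right)
    finally have "3 * pair (Phi (2 * k) ?v 0) (\<lambda>\<mu>. log_one_minus_fexp \<alpha>1 (weight \<mu>)) =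
        poly (dixon_sum 0 0 N) (of_nat (2 * k)) * poly (pderiv (dixon_sum (of_nat k) (of_nat (2 * k)) N)) (of_nat ?v)"
      unfolding N(1)[symmetric] N(2) by (simp only: mult.commute)
    then show ?thesis
      unfolding value_short[OF N(3,4), symmetric] by (simp add: field_simps)
  qed
  then show "CT (lmult
           (fexp (- 2 *\<^sub>R \<alpha>1 - \<alpha>2)
             * (\<Prod>\<alpha>\<in>short_pos_roots. 1 - fexp \<alpha>)
             * (\<Prod>\<alpha>\<in>long_roots. (1 - fexp \<alpha>) ^ k)
             * (\<Prod>\<alpha>\<in>short_roots. (1 - fexp \<alpha>) ^ m))
           (log_one_minus_fexp \<alpha>1))
         = G (2 * k) (2 * m + 1)"
    unfolding P by (simp only: CT_signed_push mult.commute)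
qed

end
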